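(* Let $G$ be a graph on $n$ vertices with a fixed labelling of its vertex set $V(G)$. For nonempty $S\subseteq V(G)$ define $F(S)$ recursively by $F(\{v\})=1$ for $v\in V(G)$ and, for $|S|\ge 2$, \[ F(S)=\sum_{v\in S}\frac{F(S\setminus\{v\})}{\binom{|S|-1}{\deg_{G[S]}v}}. \] Then \[ \mathcal{L}(G)=\frac{F(V(G))}{n!\,|\mathrm{Aut}(G)|}. \] Hence $\mathcal{L}(G)$ is computable exactly in $O(n\,2^n)$ arithmetic operations and $O(2^n)$ space.
   Context: Graphs are finite, simple and undirected. Uniform sequential attachment process: $G_1=K_1$, and for $t\ge 2$ the random graph $G_t$ is obtained from $G_{t-1}$ (which has $t-1$ vertices) as follows: choose $k$ uniformly from $\{0,1,\dots,t-1\}$, then choose a $k$-element subset $W$ of $V(G_{t-1})$ uniformly at random, then add a new vertex adjacent to exactly the vertices of $W$; all choices are independent across steps. For a graph $G$ on $n$ vertices, its likelihood is $\mathcal{L}(G)=\Pr[G_n\cong G]$. $G[S]$ is the subgraph of $G$ induced by $S$, $\deg_{G[S]}v$ is the degree of $v$ in it, and $\mathrm{Aut}(G)$ is the automorphism group of $G$. *)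

theory Defs
  imports
    "HOL-Probability.Probability"
    "HOL-Library.Landau_Symbols"
begin

section \<open>Graphs\<close>

datatype 'a graph = Graph (verts: "'a set") (edges: "'a set set")

definition simple_graph :: "'a graph \<Rightarrow> bool" where
  "simple_graph G \<longleftrightarrow>
     finite (verts G) \<and> (\<forall>e\<in>edges G. e \<subseteq> verts G \<and> card e = 2)"

definition graph_isomorphism :: "('a \<Rightarrow> 'b) \<Rightarrow> 'a graph \<Rightarrow> 'b graph \<Rightarrow> bool" where
  "graph_isomorphism f G H \<longleftrightarrow>
     bij_betw f (verts G) (verts H) \<and>
     (\<forall>u\<in>verts G. \<forall>v\<in>verts G. {u, v} \<in> edges G \<longleftrightarrow> {f u, f v} \<in> edges H)"

definition isomorphic :: "'a graph \<Rightarrow> 'b graph \<Rightarrow> bool" where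
  "isomorphic G H \<longleftrightarrow> (\<exists>f. graph_isomorphism f G H)"

text \<open>Automorphisms are taken to be the identity outside the vertex set, so that each one is
  represented by exactly one function.\<close>

definition Aut :: "'a graph \<Rightarrow> ('a \<Rightarrow> 'a) set" where
  "Aut G = {f. f permutes verts G \<and> graph_isomorphism f G G}"

definition induced_subgraph :: "'a graph \<Rightarrow> 'a set \<Rightarrow> 'a graph" where
  "induced_subgraph G S = Graph S {e \<in> edges G. e \<subseteq> S}"

definition degree :: "'a graph \<Rightarrow> 'a \<Rightarrow> nat" where
  "degree G v = card {u \<in> verts G. {u, v} \<in> edges G}"

definition add_vertex :: "'a \<Rightarrow> 'a set \<Rightarrow> 'a graph \<Rightarrow> 'a graph" where
  "add_vertex v W G = Graph (insert v (verts G)) (edges G \<union> {{v, w} |w. w \<in> W})"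


section \<open>The uniform sequential attachment process\<close>

text \<open>\<open>attachment t\<close> is the distribution of \<open>G\<^sub>t\<close>, on the vertex set \<open>{..<t}\<close>. The process
  starts at \<open>t = 1\<close>; the value at \<open>0\<close> is a dummy.\<close>

fun attachment :: "nat \<Rightarrow> nat graph pmf" where
  "attachment 0 = return_pmf (Graph {} {})"
| "attachment (Suc 0) = return_pmf (Graph {0} {})"
| "attachment (Suc (Suc t)) =
     do {
       G \<leftarrow> attachment (Suc t);
       k \<leftarrow> pmf_of_set {0..Suc t};
       W \<leftarrow> pmf_of_set {W. W \<subseteq> verts G \<and> card W = k};
       return_pmf (add_vertex (Suc t) W G)
     }"

definition likelihood :: "'a graph \<Rightarrow> real" where
  "likelihood G = measure_pmf.prob (attachment (card (verts G))) {H. isomorphic H G}"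


section \<open>The recursion over vertex subsets\<close>

text \<open>Only nonempty finite \<open>S\<close> matter; on singletons the value is \<open>1\<close>.\<close>

function F :: "'a graph \<Rightarrow> 'a set \<Rightarrow> real" where
  "F G S =
     (if finite S \<and> card S \<ge> 2
      then \<Sum>v\<in>S. F G (S - {v}) / real ((card S - 1) choose degree (induced_subgraph G S) v)
      else 1)"
  by auto
termination
  by (relation "Wellfounded.measure (\<lambda>(G, S). card S)") (auto simp: card_gt_0_iff)

declare F.simps [simp del]

lemma F_singleton: "F G {v} = 1"
  by (simp add: F.simps)

lemma F_rec:
  assumes "card S \<ge> 2"
  shows "F G S =
    (\<Sum>v\<in>S. F G (S - {v}) / real ((card S - 1) choose degree (induced_subgraph G S) v))"
proof -
  have "finite S"
    using assms by (intro card_ge_0_finite) linarith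
  with assms show ?thesis
    by (subst F.simps) simp
qed


section \<open>Random access machine with exact rational arithmetic\<close>

text \<open>
  A unit-cost random access machine, given by structured programs. A program has finitely many
  scalar variables and a memory addressed by natural numbers; both hold exact rationals of
  arbitrary size. Every arithmetic operation (the four field operations and integer part),
  constant, variable access, memory access, comparison and assignment costs at least one unit,
  so that the total cost is an upper bound for the number of arithmetic operations.
\<close>

datatype aexp =
    Const rat
  | Var string
  | Add aexp aexp
  | Sub aexp aexp
  | Mul aexp aexp
  | Div aexp aexp
  | Floor aexp

fun aval :: "aexp \<Rightarrow> (string \<Rightarrow> rat) \<Rightarrow> rat" where
  "aval (Const q) s = q"
| "aval (Var x) s = s x"
| "aval (Add a b) s = aval a s + aval b s"
| "aval (Sub a b) s = aval a s - aval b s"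
| "aval (Mul a b) s = aval a s * aval b s"
| "aval (Div a b) s = aval a s / aval b s"
| "aval (Floor a) s = of_int \<lfloor>aval a s\<rfloor>"

fun acost :: "aexp \<Rightarrow> nat" where
  "acost (Const q) = 1"
| "acost (Var x) = 1"
| "acost (Add a b) = acost a + acost b + 1"
| "acost (Sub a b) = acost a + acost b + 1"
| "acost (Mul a b) = acost a + acost b + 1"
| "acost (Div a b) = acost a + acost b + 1"
| "acost (Floor a) = acost a + 1"

datatype prog =
    Skip
  | Assign string aexp              \<comment> \<open>\<open>x := a\<close>\<close>
  | Load string aexp                \<comment> \<open>\<open>x := memory[a]\<close>\<close>
  | Store aexp aexp                 \<comment> \<open>\<open>memory[a] := b\<close>\<close>
  | Seq prog prog
  | IfLess aexp aexp prog prog      \<comment> \<open>\<open>if a < b then p else q\<close>\<close>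
  | WhileLess aexp aexp prog        \<comment> \<open>\<open>while a < b do p\<close>\<close>

type_synonym state = "(string \<Rightarrow> rat) \<times> (nat \<Rightarrow> rat)"

text \<open>
  \<open>exec m p \<sigma> k \<sigma>'\<close>: with \<open>m\<close> memory cells, program \<open>p\<close> started in \<open>\<sigma>\<close> terminates in \<open>\<sigma>'\<close> after
  \<open>k\<close> units of cost. An access to an address that is not a natural number below \<open>m\<close> has no
  transition.
\<close>

inductive exec :: "nat \<Rightarrow> prog \<Rightarrow> state \<Rightarrow> nat \<Rightarrow> state \<Rightarrow> bool" for m :: nat where
  Skip: "exec m Skip \<sigma> 1 \<sigma>"
| Assign: "exec m (Assign x a) (s, h) (acost a + 1) (s(x := aval a s), h)"
| Load: "aval a s = of_nat i \<Longrightarrow> i < m \<Longrightarrow>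
    exec m (Load x a) (s, h) (acost a + 1) (s(x := h i), h)"
| Store: "aval a s = of_nat i \<Longrightarrow> i < m \<Longrightarrow>
    exec m (Store a b) (s, h) (acost a + acost b + 1) (s, h(i := aval b s))"
| Seq: "exec m p \<sigma> k \<sigma>' \<Longrightarrow> exec m q \<sigma>' l \<sigma>'' \<Longrightarrow> exec m (Seq p q) \<sigma> (k + l) \<sigma>''"
| IfTrue: "aval a s < aval b s \<Longrightarrow> exec m p (s, h) k \<sigma>' \<Longrightarrow>
    exec m (IfLess a b p q) (s, h) (acost a + acost b + 1 + k) \<sigma>'"
| IfFalse: "\<not> aval a s < aval b s \<Longrightarrow> exec m q (s, h) k \<sigma>' \<Longrightarrow>
    exec m (IfLess a b p q) (s, h) (acost a + acost b + 1 + k) \<sigma>'"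
| WhileFalse: "\<not> aval a s < aval b s \<Longrightarrow>
    exec m (WhileLess a b p) (s, h) (acost a + acost b + 1) (s, h)"
| WhileTrue: "aval a s < aval b s \<Longrightarrow> exec m p (s, h) k \<sigma>' \<Longrightarrow>
    exec m (WhileLess a b p) \<sigma>' l \<sigma>'' \<Longrightarrow>
    exec m (WhileLess a b p) (s, h) (acost a + acost b + 1 + k + l) \<sigma>''"

inductive_cases SkipE: "exec m Skip \<sigma> k \<sigma>'"
inductive_cases AssignE: "exec m (Assign x a) \<sigma> k \<sigma>'"
inductive_cases LoadE: "exec m (Load x a) \<sigma> k \<sigma>'"
inductive_cases StoreE: "exec m (Store a b) \<sigma> k \<sigma>'"
inductive_cases SeqE: "exec m (Seq p q) \<sigma> k \<sigma>'"
inductive_cases IfE: "exec m (IfLess a b p q) \<sigma> k \<sigma>'"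
inductive_cases WhileE: "exec m (WhileLess a b p) \<sigma> k \<sigma>'"

lemma exec_deterministic:
  "exec m p \<sigma> k \<sigma>' \<Longrightarrow> exec m p \<sigma> l \<sigma>'' \<Longrightarrow> k = l \<and> \<sigma>' = \<sigma>''"
proof (induction arbitrary: l \<sigma>'' rule: exec.induct)
  case (Skip \<sigma>)
  from Skip.prems show ?case by (rule SkipE) auto
next
  case (Assign x a s h)
  from Assign.prems show ?case by (rule AssignE) auto
next
  case (Load a s i x h)
  from Load.prems show ?case by (rule LoadE) (use Load.hyps in auto)
next
  case (Store a s i b h)
  from Store.prems show ?case by (rule StoreE) (use Store.hyps in auto)
next
  case (Seq p \<sigma> k \<sigma>' q l' \<tau>)
  from Seq.prems show ?case
  proof (rule SeqE)
    fix k0 \<sigma>0 l0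
    assume *: "l = k0 + l0" "exec m p \<sigma> k0 \<sigma>0" "exec m q \<sigma>0 l0 \<sigma>''"
    then have "k = k0 \<and> \<sigma>' = \<sigma>0" using Seq.IH(1) by simp
    with * show ?thesis using Seq.IH(2) by simp
  qed
next
  case (IfTrue a s b p h k \<sigma>' q)
  from IfTrue.prems show ?case
  proof (rule IfE)
    fix s0 h0 k0
    assume *: "(s, h) = (s0, h0)" "l = Suc (acost a + acost b + k0)" "exec m p (s0, h0) k0 \<sigma>''"
    then have "k = k0 \<and> \<sigma>' = \<sigma>''" using IfTrue.IH by simp
    with * show ?thesis by simp
  qed (use IfTrue.hyps in auto)
next
  case (IfFalse a s b q h k \<sigma>' p)
  from IfFalse.prems show ?case
  proof (rule IfE)
    fix s0 h0 k0
    assume *: "(s, h) = (s0, h0)" "l = Suc (acost a + acost b + k0)" "exec m q (s0, h0) k0 \<sigma>''"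
    then have "k = k0 \<and> \<sigma>' = \<sigma>''" using IfFalse.IH by simp
    with * show ?thesis by simp
  qed (use IfFalse.hyps in auto)
next
  case (WhileFalse a s b p h)
  from WhileFalse.prems show ?case
    by (rule WhileE) (use WhileFalse.hyps in auto)
next
  case (WhileTrue a s b p h k \<sigma>' l' \<tau>)
  from WhileTrue.prems show ?case
  proof (rule WhileE)
    fix s0 h0 k0 \<sigma>0 l0
    assume *: "(s, h) = (s0, h0)" "l = Suc (acost a + acost b + k0 + l0)"
      "exec m p (s0, h0) k0 \<sigma>0" "exec m (WhileLess a b p) \<sigma>0 l0 \<sigma>''"
    then have "k = k0 \<and> \<sigma>' = \<sigma>0" using WhileTrue.IH(1) by simp
    with * show ?thesis using WhileTrue.IH(2) by simp
  qed (use WhileTrue.hyps in auto)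
qed

text \<open>The input is the adjacency matrix of a graph with vertex set \<open>{..<n}\<close>, stored row by row,
  together with \<open>n\<close> in a scalar variable. Everything else is initially zero.\<close>

definition input_state :: "nat \<Rightarrow> nat graph \<Rightarrow> state" where
  "input_state n G =
     ((\<lambda>x. 0)(''n'' := of_nat n),
      (\<lambda>a. if a < n * n \<and> {a div n, a mod n} \<in> edges G then 1 else 0))"

definition result :: "state \<Rightarrow> rat" where
  "result \<sigma> = fst \<sigma> ''result''"

text \<open>A single program has to serve all \<open>n\<close> and all graphs on \<open>{..<n}\<close>.\<close>

definition computable_within ::
    "(nat graph \<Rightarrow> real) \<Rightarrow> (nat \<Rightarrow> real) \<Rightarrow> (nat \<Rightarrow> real) \<Rightarrow> bool" where
  "computable_within f t_bound s_bound \<longleftrightarrow>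
     (\<exists>p (T :: nat \<Rightarrow> nat) (M :: nat \<Rightarrow> nat).
        (\<lambda>n. real (T n)) \<in> O(t_bound) \<and> (\<lambda>n. real (M n)) \<in> O(s_bound) \<and>
        (\<forall>n\<ge>1. \<forall>G. simple_graph G \<and> verts G = {..<n} \<longrightarrow>
           (\<exists>k \<sigma>. exec (M n) p (input_state n G) k \<sigma> \<and> k \<le> T n \<and>
                   of_rat (result \<sigma>) = f G)))"

end

theory Submission
  imports Defs "HOL-Library.Nat_Bijection" "HOL-Real_Asymp.Real_Asymp"
begin

text \<open>\<^bold>\<open>The formula.\<close> An ordering \<open>\<sigma>\<close> of \<open>V(G)\<close>, a bijection from \<open>{..<n}\<close>, pulls \<open>G\<close> back to a labelled
  graph on \<open>{..<n}\<close>. The process produces this labelled graph in exactly one way, and the step that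
  adds its vertex \<open>t\<close> has probability \<open>1/(t+1)\<close> for the size of the neighbourhood times one over a
  binomial coefficient for the neighbourhood itself (\<open>pmf_attachment_Suc\<close>). The factors \<open>1/(t+1)\<close>
  multiply to \<open>1/n!\<close>; the product of the binomial factors, summed over all orderings, is \<open>F\<close>,
  because the recursion for \<open>F\<close> chooses the last vertex of an ordering first (\<open>sum_pmf_relabel\<close>).
  Two orderings give the same labelled graph exactly if they differ by an automorphism, so each
  labelled copy of \<open>G\<close> is counted \<open>|Aut(G)|\<close> times (\<open>card_relabel_fibre\<close>).

  \<^bold>\<open>The algorithm.\<close> The table of \<open>F\<close> over all subsets is filled in the order of their binary codes.
  The degrees in \<open>G[S]\<close> of all vertices are the digits, in base \<open>n\<close>, of a single number, the sum of
  the packed adjacency rows of the elements of \<open>S\<close>; reading one digit costs constant time, so a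
  subset costs \<open>O(n)\<close>.

  What remains is \<open>|Aut(G)|\<close>, and here the unbounded size of the numbers is what keeps the cost
  down. A permutation with matrix \<open>P\<close> is an automorphism exactly if \<open>PA = AP\<close> for the adjacency matrix
  \<open>A\<close>, a condition that is \<^emph>\<open>linear\<close> in \<open>P\<close>. The entries of \<open>PA - AP\<close> lie in \<open>{-1,0,1}\<close>, so they all
  vanish if and only if the number with these balanced ternary digits vanishes. By linearity this
  number is a sum \<open>\<Sum>u. w(u, \<sigma>(u))\<close> of weights of the nonzero positions of \<open>P\<close>, and therefore the
  permanent of the matrix with entries \<open>x ^ w(u, v)\<close> is a Laurent polynomial in \<open>x\<close> whose constant
  coefficient is \<open>|Aut(G)|\<close>. Evaluated at \<open>x = n! + 1\<close>, which exceeds the sum of all coefficients,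
  this coefficient is a digit of the value and two integer parts extract it
  (\<open>card_Aut_eq_floor\<close>). A permanent satisfies a recursion over column subsets of the same shape as
  that of \<open>F\<close> (\<open>perm_sum_rec\<close>), so the same loop computes both in \<open>O(n 2\<^sup>n)\<close> operations.

  Correctness and cost of the program are derived together with weakest preconditions whose
  postconditions see the cost.\<close>

section \<open>Orderings and the labelled graphs they induce\<close>

text \<open>Restriction to extensional functions makes each ordering of \<open>S\<close> a single function, so that sums
  over orderings count each of them once.\<close>

definition orderings :: "nat \<Rightarrow> 'a set \<Rightarrow> (nat \<Rightarrow> 'a) set" where
  "orderings t S = {\<sigma>. \<sigma> \<in> extensional {..<t} \<and> bij_betw \<sigma> {..<t} S}"

lemma orderings_0: "orderings 0 {} = {\<lambda>x. undefined}"
  by (auto simp: orderings_def bij_betw_def)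

lemma finite_orderings:
  assumes "finite S" shows "finite (orderings t S)"
proof (rule finite_subset)
  show "orderings t S \<subseteq> {..<t} \<rightarrow>\<^sub>E S"
    by (auto simp: orderings_def PiE_iff extensional_def dest: bij_betwE)
  show "finite ({..<t} \<rightarrow>\<^sub>E S)"
    using assms by (intro finite_PiE) auto
qed

lemma bij_betw_lessThan_Suc_upd:
  assumes "bij_betw \<sigma> {..<t} (S - {v})" "v \<in> S"
  shows "bij_betw (\<sigma>(t := v)) {..<Suc t} S"
proof -
  have "bij_betw (\<sigma>(t := v)) {..<t} (S - {v})"
    using assms(1) by (subst bij_betw_cong[where g = \<sigma>]) auto
  moreover have "bij_betw (\<sigma>(t := v)) {t} {v}" by auto
  ultimately have "bij_betw (\<sigma>(t := v)) ({..<t} \<union> {t}) ((S - {v}) \<union> {v})"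
    by (rule bij_betw_combine) auto
  moreover have "{..<t} \<union> {t} = {..<Suc t}" "(S - {v}) \<union> {v} = S" using assms(2) by auto
  ultimately show ?thesis by simp
qed

text \<open>An ordering is its last element together with an ordering of the others. Both \<open>F\<close> and the
  permanent inherit their recursions over subsets from this decomposition.\<close>

lemma sum_orderings_Suc:
  fixes g :: "(nat \<Rightarrow> 'a) \<Rightarrow> 'b::comm_monoid_add"
  assumes "finite S"
  shows "sum g (orderings (Suc t) S) = (\<Sum>v\<in>S. \<Sum>\<sigma>\<in>orderings t (S - {v}). g (\<sigma>(t := v)))"
proof -
  have "(\<Sum>v\<in>S. \<Sum>\<sigma>\<in>orderings t (S - {v}). g (\<sigma>(t := v)))
      = (\<Sum>(v, \<sigma>)\<in>(SIGMA v:S. orderings t (S - {v})). g (\<sigma>(t := v)))"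
    using assms by (intro sum.Sigma) (auto intro: finite_orderings)
  also have "\<dots> = sum g (orderings (Suc t) S)"
  proof (rule sum.reindex_bij_witness[where j = "\<lambda>(v, \<sigma>). \<sigma>(t := v)"
        and i = "\<lambda>\<sigma>. (\<sigma> t, restrict \<sigma> {..<t})"])
    fix a assume "a \<in> (SIGMA v:S. orderings t (S - {v}))"
    then obtain v \<sigma> where a: "a = (v, \<sigma>)" "v \<in> S" "\<sigma> \<in> extensional {..<t}"
      "bij_betw \<sigma> {..<t} (S - {v})"
      by (auto simp: orderings_def)
    have "restrict (\<sigma>(t := v)) {..<t} = \<sigma>"
      using a(3) by (auto simp: fun_eq_iff restrict_def extensional_def)
    then show "(\<lambda>\<sigma>. (\<sigma> t, restrict \<sigma> {..<t})) ((\<lambda>(v, \<sigma>). \<sigma>(t := v)) a) = a"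
      using a by simp
    show "(\<lambda>(v, \<sigma>). \<sigma>(t := v)) a \<in> orderings (Suc t) S"
      using a bij_betw_lessThan_Suc_upd[OF a(4) a(2)]
      by (auto simp: orderings_def extensional_def)
    show "g ((\<lambda>(v, \<sigma>). \<sigma>(t := v)) a) = (\<lambda>(v, \<sigma>). g (\<sigma>(t := v))) a"
      using a by simp
  next
    fix \<sigma> assume "\<sigma> \<in> orderings (Suc t) S"
    then have \<sigma>: "\<sigma> \<in> extensional {..<Suc t}" "bij_betw \<sigma> {..<Suc t} S"
      by (auto simp: orderings_def)
    show "(\<lambda>(v, \<sigma>). \<sigma>(t := v)) ((\<lambda>\<sigma>. (\<sigma> t, restrict \<sigma> {..<t})) \<sigma>) = \<sigma>"
      using \<sigma>(1) by (auto simp: fun_eq_iff restrict_def extensional_def)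
    have tS: "\<sigma> t \<in> S" by (rule bij_betw_apply[OF \<sigma>(2)]) simp
    have "bij_betw \<sigma> ({..<Suc t} - {t}) (S - {\<sigma> t})"
      by (rule bij_betw_DiffI[OF \<sigma>(2)]) (use tS in auto)
    moreover have "{..<Suc t} - {t} = {..<t}" by auto
    ultimately have "bij_betw (restrict \<sigma> {..<t}) {..<t} (S - {\<sigma> t})"
      by (subst bij_betw_cong[where g = \<sigma>]) auto
    with tS show "(\<lambda>\<sigma>. (\<sigma> t, restrict \<sigma> {..<t})) \<sigma> \<in> (SIGMA v:S. orderings t (S - {v}))"
      by (auto simp: orderings_def)
  qed
  finally show ?thesis by simp
qed

text \<open>The pullback of \<open>G\<close> along \<open>\<sigma>\<close>: the vertex \<open>\<sigma> i\<close> gets the label \<open>i\<close>.\<close>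

definition relabel :: "'a graph \<Rightarrow> nat \<Rightarrow> (nat \<Rightarrow> 'a) \<Rightarrow> nat graph" where
  "relabel G t \<sigma> = Graph {..<t} {{i, j} |i j. i < t \<and> j < t \<and> {\<sigma> i, \<sigma> j} \<in> edges G}"

definition labelled_graph :: "nat \<Rightarrow> nat graph \<Rightarrow> bool" where
  "labelled_graph t H \<longleftrightarrow> verts H = {..<t} \<and> (\<forall>e\<in>edges H. e \<subseteq> {..<t} \<and> card e = 2)"

lemma simple_graph_no_loop: "simple_graph G \<Longrightarrow> {v} \<notin> edges G"
  by (auto simp: simple_graph_def)

lemma labelled_graph_relabel:
  assumes "simple_graph G" "inj_on \<sigma> {..<t}"
  shows "labelled_graph t (relabel G t \<sigma>)"
  using simple_graph_no_loop[OF assms(1)]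
  by (auto simp: labelled_graph_def relabel_def card_2_iff) (metis insert_absorb2)

lemma edge_relabel_iff:
  assumes "i < t" "j < t"
  shows "{i, j} \<in> edges (relabel G t \<sigma>) \<longleftrightarrow> {\<sigma> i, \<sigma> j} \<in> edges G"
  using assms by (auto simp: relabel_def doubleton_eq_iff insert_commute)

lemma relabel_Suc:
  assumes "simple_graph G"
  shows "relabel G (Suc t) (\<sigma>(t := v)) =
    add_vertex t {i \<in> {..<t}. {\<sigma> i, v} \<in> edges G} (relabel G t \<sigma>)"
proof -
  let ?W = "{i \<in> {..<t}. {\<sigma> i, v} \<in> edges G}"
  have "{{i, j} |i j. i < Suc t \<and> j < Suc t \<and> {(\<sigma>(t := v)) i, (\<sigma>(t := v)) j} \<in> edges G}
    = {{i, j} |i j. i < t \<and> j < t \<and> {\<sigma> i, \<sigma> j} \<in> edges G} \<union> {{t, w} |w. w \<in> ?W}"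
    (is "?L = ?R")
  proof (intro equalityI subsetI)
    fix e assume "e \<in> ?L"
    then obtain i j where e: "e = {i, j}" "i < Suc t" "j < Suc t"
      "{(\<sigma>(t := v)) i, (\<sigma>(t := v)) j} \<in> edges G" by blast
    have "i \<noteq> t \<or> j \<noteq> t" using e(4) simple_graph_no_loop[OF assms, of v] by auto
    then consider "i < t" "j < t" | "i = t" "j < t" | "i < t" "j = t" using e(2,3) by linarith
    then show "e \<in> ?R"
    proof cases
      case 1
      then show ?thesis using e by auto
    next
      case 2
      then have "j \<in> ?W" using e by (auto simp: insert_commute)
      then show ?thesis using e 2 by blast
    next
      case 3
      then have "i \<in> ?W" using e by auto
      then show ?thesis using e 3 by blast
    qed
  next
    fix e assume "e \<in> ?R"
    then consider i j where "e = {i, j}" "i < t" "j < t" "{\<sigma> i, \<sigma> j} \<in> edges G"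
      | w where "e = {w, t}" "w < t" "{\<sigma> w, v} \<in> edges G"
      by blast
    then show "e \<in> ?L"
    proof cases
      case 1
      then show ?thesis by (intro CollectI exI[of _ i] exI[of _ j]) simp
    next
      case 2
      then show ?thesis by (intro CollectI exI[of _ w] exI[of _ t]) simp
    qed
  qed
  moreover have "{..<Suc t} = insert t {..<t}" by auto
  ultimately show ?thesis by (simp add: relabel_def add_vertex_def)
qed

section \<open>The distribution of the attachment process\<close>

text \<open>The dummy value at \<open>0\<close> is the empty graph, from which the general step produces \<open>K\<^sub>1\<close> with
  probability one. Hence one recursion covers all \<open>t\<close>, and inductions can start at \<open>0\<close>.\<close>

lemma attachment_Suc:
  "attachment (Suc t) =
     attachment t \<bind> (\<lambda>G. pmf_of_set {0..t} \<bind> (\<lambda>k.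
       pmf_of_set {W. W \<subseteq> verts G \<and> card W = k} \<bind> (\<lambda>W. return_pmf (add_vertex t W G))))"
proof (cases t)
  case 0
  have "{W. W = {} \<and> card W = 0} = {{} :: nat set}" by auto
  then show ?thesis using 0
    by (simp add: bind_return_pmf pmf_of_set_singleton add_vertex_def)
qed simp

lemma set_pmf_attachment:
  "H \<in> set_pmf (attachment t) \<Longrightarrow> labelled_graph t H"
proof (induction t arbitrary: H)
  case 0
  then show ?case by (simp add: labelled_graph_def)
next
  case (Suc t)
  then obtain H' k W where H': "H' \<in> set_pmf (attachment t)" "k \<in> set_pmf (pmf_of_set {0..t})"
    "W \<in> set_pmf (pmf_of_set {W. W \<subseteq> verts H' \<and> card W = k})" "H = add_vertex t W H'"
    unfolding attachment_Suc by (auto simp del: attachment.simps)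
  have l: "labelled_graph t H'" using Suc.IH H'(1) .
  have "k \<le> t" using H'(2) by (simp add: set_pmf_of_set)
  then obtain W0 where "W0 \<subseteq> {..<t}" "card W0 = k"
    by (metis card_lessThan obtain_subset_with_card_n)
  then have "{W. W \<subseteq> verts H' \<and> card W = k} \<noteq> {}"
    using l by (auto simp: labelled_graph_def)
  moreover have "finite {W. W \<subseteq> verts H' \<and> card W = k}"
    using l by (auto simp: labelled_graph_def)
  ultimately have "W \<subseteq> {..<t}"
    using H'(3) l by (auto simp: labelled_graph_def)
  then show ?case
    using l H'(4) by (fastforce simp: labelled_graph_def add_vertex_def)
qed

text \<open>The vertex \<open>t\<close> is new, so the edges at \<open>t\<close> reveal \<open>W\<close> and the other edges reveal the old graph. This
  is why each labelled graph arises in only one way.\<close>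

lemma add_vertex_inject:
  assumes "labelled_graph t H" "labelled_graph t H'" "W \<subseteq> {..<t}" "W' \<subseteq> {..<t}"
    and eq: "add_vertex t W H = add_vertex t W' H'"
  shows "H = H' \<and> W = W'"
proof -
  have *: "{e \<in> edges (add_vertex t W H). t \<notin> e} = edges H"
    "{w. w \<noteq> t \<and> {t, w} \<in> edges (add_vertex t W H)} = W"
    if "labelled_graph t H" "W \<subseteq> {..<t}" for H W
    using that by (auto simp: labelled_graph_def add_vertex_def doubleton_eq_iff)
  have "edges H = edges H'" "W = W'"
    using *[OF assms(1,3)] *[OF assms(2,4)] eq by auto
  then show ?thesis using assms(1,2) by (auto simp: labelled_graph_def graph.expand)
qed

text \<open>By injectivity only the predecessor \<open>H\<close>, the size \<open>card W\<close> and the set \<open>W\<close> contribute; the size has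
  probability \<open>1/(t+1)\<close>, and the set is one of \<open>t choose card W\<close>.\<close>

lemma pmf_attachment_Suc:
  assumes H: "labelled_graph t H" and W: "W \<subseteq> {..<t}"
  shows "pmf (attachment (Suc t)) (add_vertex t W H) =
    pmf (attachment t) H / (real (Suc t) * real (t choose card W))"
proof -
  let ?c = "1 / (real (Suc t) * real (t choose card W))"
  let ?step = "\<lambda>G. pmf_of_set {0..t} \<bind> (\<lambda>k.
       pmf_of_set {W. W \<subseteq> verts G \<and> card W = k} \<bind> (\<lambda>W. return_pmf (add_vertex t W G)))"
  have step: "pmf (?step H') (add_vertex t W H) = ?c * indicator {H} H'"
    if "H' \<in> set_pmf (attachment t)" for H'
  proof -
    have l: "labelled_graph t H'" using set_pmf_attachment that .
    then have v: "verts H' = {..<t}" by (simp add: labelled_graph_def)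
    have "card W \<le> t" using W card_mono[of "{..<t}" W] by simp
    have inner: "pmf (pmf_of_set {W. W \<subseteq> verts H' \<and> card W = k} \<bind>
        (\<lambda>W. return_pmf (add_vertex t W H'))) (add_vertex t W H) =
        (if k = card W then indicator {H} H' / real (t choose card W) else 0)"
      if "k \<in> {0..t}" for k
    proof -
      let ?A = "{W. W \<subseteq> {..<t} \<and> card W = k}"
      have card: "card ?A = t choose k"
        using n_subsets[of "{..<t}" k] by simp
      have fin: "finite ?A" by auto
      have "t choose k > 0" using \<open>k \<in> {0..t}\<close> by simp
      then have ne: "?A \<noteq> {}" using card by (metis card.empty less_irrefl)
      have ind: "indicator {add_vertex t W H} (add_vertex t W' H') =
          (indicator {H} H' * (if W' = W then 1 else 0) :: real)" if "W' \<in> ?A" for W'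
        using add_vertex_inject[OF H l W, of W'] that by (auto simp: indicator_def)
      have "pmf (pmf_of_set ?A \<bind> (\<lambda>W. return_pmf (add_vertex t W H'))) (add_vertex t W H)
        = (\<Sum>W'\<in>?A. indicator {add_vertex t W H} (add_vertex t W' H')) / real (card ?A)"
        using fin ne
        by (subst pmf_bind_pmf_of_set) (auto simp: indicator_def intro!: sum.cong)
      also have "(\<Sum>W'\<in>?A. indicator {add_vertex t W H} (add_vertex t W' H') :: real)
        = (\<Sum>W'\<in>?A. indicator {H} H' * (if W' = W then 1 else 0))"
        using ind by (rule sum.cong[OF refl])
      also have "\<dots> = (if card W = k then indicator {H} H' else 0)"
        using fin W by (simp add: sum_distrib_left[symmetric] sum.delta)
      finally show ?thesis using card v by auto
    qed
    have "pmf (?step H') (add_vertex t W H) =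
      (\<Sum>k\<in>{0..t}. (if k = card W then indicator {H} H' / real (t choose card W) else 0)) / real (Suc t)"
      using inner by (subst pmf_bind_pmf_of_set) (auto simp: algebra_simps intro!: sum.cong)
    also have "\<dots> = ?c * indicator {H} H'"
      using \<open>card W \<le> t\<close> by (simp add: sum.delta)
    finally show ?thesis .
  qed
  have "pmf (attachment (Suc t)) (add_vertex t W H) =
     (\<integral>H'. pmf (?step H') (add_vertex t W H) \<partial>measure_pmf (attachment t))"
    unfolding attachment_Suc by (rule pmf_bind)
  also have "\<dots> = (\<integral>H'. ?c * indicator {H} H' \<partial>measure_pmf (attachment t))"
    using step by (intro integral_cong_AE) (auto simp: AE_measure_pmf_iff)
  also have "\<dots> = ?c * pmf (attachment t) H"
    by (simp add: pmf.rep_eq)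
  finally show ?thesis by simp
qed

section \<open>The formula for the likelihood\<close>

text \<open>On singletons the general recursion gives \<open>F G {} / (0 choose 0) = 1\<close>, so the value \<open>1\<close> that \<open>F\<close>
  takes at the empty set turns it into a recursion with a single base case.\<close>

lemma F_rec_nonempty:
  assumes "simple_graph G" "finite S" "S \<noteq> {}"
  shows "F G S =
    (\<Sum>v\<in>S. F G (S - {v}) / real ((card S - 1) choose degree (induced_subgraph G S) v))"
proof (cases "card S \<ge> 2")
  case True
  then show ?thesis by (rule F_rec)
next
  case False
  have "card S > 0" using assms by (simp add: card_gt_0_iff)
  with False have "card S = 1" by linarith
  then obtain v where S: "S = {v}" by (auto simp: card_1_singleton_iff)
  have "degree (induced_subgraph G {v}) v = 0"
    using simple_graph_no_loop[OF assms(1)] by (auto simp: degree_def induced_subgraph_def)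
  moreover have "F G {} = 1" by (simp add: F.simps)
  ultimately show ?thesis by (simp add: S F_singleton)
qed

text \<open>Induction on the size: splitting off the last vertex \<open>v\<close> of the ordering produces both the
  recursion for \<open>F\<close> and, by \<open>pmf_attachment_Suc\<close>, the factor for the step that attaches \<open>v\<close>. The
  neighbourhood drawn in that step has as many elements as \<open>v\<close> has neighbours in \<open>G[S]\<close>.\<close>

lemma sum_pmf_relabel:
  assumes G: "simple_graph G" and "finite S" "card S = t"
  shows "(\<Sum>\<sigma>\<in>orderings t S. pmf (attachment t) (relabel G t \<sigma>)) = F G S / fact t"
  using assms(2,3)
proof (induction t arbitrary: S)
  case 0
  then have "S = {}" by simp
  then show ?case by (simp add: orderings_0 relabel_def F.simps)
next
  case (Suc t)
  let ?d = "\<lambda>v. real (t choose degree (induced_subgraph G S) v)"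
  have "pmf (attachment (Suc t)) (relabel G (Suc t) (\<sigma>(t := v)))
      = pmf (attachment t) (relabel G t \<sigma>) / (real (Suc t) * ?d v)"
    if v: "v \<in> S" and \<sigma>: "\<sigma> \<in> orderings t (S - {v})" for v \<sigma>
  proof -
    let ?W = "{i \<in> {..<t}. {\<sigma> i, v} \<in> edges G}"
    have bij: "bij_betw \<sigma> {..<t} (S - {v})" using \<sigma> by (simp add: orderings_def)
    then have inj: "inj_on \<sigma> {..<t}" by (simp add: bij_betw_def)
    have "\<sigma> ` ?W = {u \<in> \<sigma> ` {..<t}. {u, v} \<in> edges G}" by auto
    also have "\<sigma> ` {..<t} = S - {v}" using bij by (simp add: bij_betw_def)
    also have "{u \<in> S - {v}. {u, v} \<in> edges G} =
        {u \<in> verts (induced_subgraph G S). {u, v} \<in> edges (induced_subgraph G S)}"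
      using v simple_graph_no_loop[OF G] by (auto simp: induced_subgraph_def)
    finally have "card ?W = degree (induced_subgraph G S) v"
      using card_image[OF inj_on_subset[OF inj, of ?W]] unfolding degree_def by force
    then show ?thesis
      unfolding relabel_Suc[OF G]
      by (subst pmf_attachment_Suc[OF labelled_graph_relabel[OF G inj]]) auto
  qed
  then have "(\<Sum>\<sigma>\<in>orderings (Suc t) S. pmf (attachment (Suc t)) (relabel G (Suc t) \<sigma>))
    = (\<Sum>v\<in>S. \<Sum>\<sigma>\<in>orderings t (S - {v}). pmf (attachment t) (relabel G t \<sigma>) / (real (Suc t) * ?d v))"
    unfolding sum_orderings_Suc[OF Suc.prems(1)] by (intro sum.cong) simp_all
  also have "\<dots> = (\<Sum>v\<in>S. F G (S - {v}) / fact t / (real (Suc t) * ?d v))"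
    using Suc.prems by (simp add: sum_divide_distrib[symmetric] Suc.IH del: of_nat_Suc)
  also have "\<dots> = (\<Sum>v\<in>S. F G (S - {v}) / ?d v) / fact (Suc t)"
    by (simp add: sum_divide_distrib field_simps del: of_nat_Suc)
  also have "(\<Sum>v\<in>S. F G (S - {v}) / ?d v) = F G S"
  proof -
    have "S \<noteq> {}" using Suc.prems by auto
    then show ?thesis using F_rec_nonempty[OF G Suc.prems(1), of] Suc.prems(2) by simp
  qed
  finally show ?case .
qed

lemma labelled_graph_eqI:
  assumes "labelled_graph t H" "labelled_graph t H'"
    and "\<And>i j. i < t \<Longrightarrow> j < t \<Longrightarrow> {i, j} \<in> edges H \<longleftrightarrow> {i, j} \<in> edges H'"
  shows "H = H'"
proof -
  have *: "edges H = {{i, j} |i j. i < t \<and> j < t \<and> {i, j} \<in> edges H}"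
    if "labelled_graph t H" for H
  proof (intro equalityI subsetI)
    fix e assume e: "e \<in> edges H"
    with that have "e \<subseteq> {..<t}" "card e = 2" by (auto simp: labelled_graph_def)
    moreover from this obtain i j where "e = {i, j}" by (auto simp: card_2_iff)
    ultimately show "e \<in> {{i, j} |i j. i < t \<and> j < t \<and> {i, j} \<in> edges H}"
      using e by (intro CollectI exI[of _ i] exI[of _ j]) auto
  qed auto
  have "edges H = edges H'"
    using assms(3) by (subst *[OF assms(1)], subst *[OF assms(2)]) blast
  then show ?thesis using assms(1,2) by (auto simp: labelled_graph_def graph.expand)
qed

lemma isomorphic_iff_relabel:
  assumes G: "simple_graph G" and n: "card (verts G) = n" and H: "labelled_graph n H"
  shows "isomorphic H G \<longleftrightarrow> H \<in> relabel G n ` orderings n (verts G)"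
proof
  assume "isomorphic H G"
  then obtain f where f: "bij_betw f {..<n} (verts G)"
    "\<And>u v. u < n \<Longrightarrow> v < n \<Longrightarrow> {u, v} \<in> edges H \<longleftrightarrow> {f u, f v} \<in> edges G"
    using H by (auto simp: isomorphic_def graph_isomorphism_def labelled_graph_def)
  let ?\<sigma> = "restrict f {..<n}"
  have \<sigma>: "?\<sigma> \<in> orderings n (verts G)" using f(1) by (simp add: orderings_def)
  then have "labelled_graph n (relabel G n ?\<sigma>)"
    by (intro labelled_graph_relabel G) (simp add: orderings_def bij_betw_def)
  then have "H = relabel G n ?\<sigma>"
    using f(2) by (intro labelled_graph_eqI[OF H]) (auto simp: edge_relabel_iff)
  then show "H \<in> relabel G n ` orderings n (verts G)" using \<sigma> by blast
next
  assume "H \<in> relabel G n ` orderings n (verts G)"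
  then obtain \<sigma> where "\<sigma> \<in> orderings n (verts G)" and H_eq: "H = relabel G n \<sigma>" by auto
  then have "graph_isomorphism \<sigma> H G"
    using H by (auto simp: graph_isomorphism_def orderings_def edge_relabel_iff labelled_graph_def)
  then show "isomorphic H G" by (auto simp: isomorphic_def)
qed

lemma relabel_eq_iff:
  assumes G: "simple_graph G" and \<sigma>: "\<sigma> \<in> orderings n (verts G)" and \<tau>: "\<tau> \<in> orderings n (verts G)"
  shows "relabel G n \<sigma> = relabel G n \<tau> \<longleftrightarrow>
    (\<forall>i<n. \<forall>j<n. {\<sigma> i, \<sigma> j} \<in> edges G \<longleftrightarrow> {\<tau> i, \<tau> j} \<in> edges G)"
proof
  assume "relabel G n \<sigma> = relabel G n \<tau>"
  then show "\<forall>i<n. \<forall>j<n. {\<sigma> i, \<sigma> j} \<in> edges G \<longleftrightarrow> {\<tau> i, \<tau> j} \<in> edges G"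
    by (metis edge_relabel_iff)
next
  assume "\<forall>i<n. \<forall>j<n. {\<sigma> i, \<sigma> j} \<in> edges G \<longleftrightarrow> {\<tau> i, \<tau> j} \<in> edges G"
  then show "relabel G n \<sigma> = relabel G n \<tau>"
    using \<sigma> \<tau>
    by (intro labelled_graph_eqI[of n] labelled_graph_relabel G)
      (auto simp: edge_relabel_iff orderings_def bij_betw_def)
qed

text \<open>Composition with \<open>\<sigma>0\<close> identifies the automorphisms with the orderings that induce the same
  labelled graph as \<open>\<sigma>0\<close>; the inverse map sends \<open>\<sigma>\<close> to \<open>\<sigma> \<circ> \<sigma>0\<^sup>-\<^sup>1\<close>.\<close>

lemma card_relabel_fibre:
  assumes G: "simple_graph G" and \<sigma>0: "\<sigma>0 \<in> orderings n (verts G)"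
  shows "card {\<sigma> \<in> orderings n (verts G). relabel G n \<sigma> = relabel G n \<sigma>0} = card (Aut G)"
proof -
  let ?V = "verts G"
  let ?B = "{\<sigma> \<in> orderings n ?V. relabel G n \<sigma> = relabel G n \<sigma>0}"
  let ?inv = "inv_into {..<n} \<sigma>0"
  have b0: "bij_betw \<sigma>0 {..<n} ?V" and e0: "\<sigma>0 \<in> extensional {..<n}"
    using \<sigma>0 by (auto simp: orderings_def)
  have inv1: "?inv v < n" "\<sigma>0 (?inv v) = v" if "v \<in> ?V" for v
    using that bij_betw_inv_into_right[OF b0 that] bij_betw_apply[OF bij_betw_inv_into[OF b0] that]
    by auto
  have inv2: "\<sigma>0 i \<in> ?V" "?inv (\<sigma>0 i) = i" if "i < n" for i
    using that bij_betw_inv_into_left[OF b0] bij_betw_apply[OF b0] by auto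
  have fibre: "\<sigma> \<in> ?B \<longleftrightarrow> \<sigma> \<in> orderings n ?V \<and>
      (\<forall>i<n. \<forall>j<n. {\<sigma> i, \<sigma> j} \<in> edges G \<longleftrightarrow> {\<sigma>0 i, \<sigma>0 j} \<in> edges G)" for \<sigma>
    using relabel_eq_iff[OF G _ \<sigma>0] by blast
  have "bij_betw (\<lambda>\<alpha>. restrict (\<alpha> \<circ> \<sigma>0) {..<n}) (Aut G) ?B"
  proof (rule bij_betwI[where g = "\<lambda>\<sigma> v. if v \<in> ?V then \<sigma> (?inv v) else v"])
    show "(\<lambda>\<alpha>. restrict (\<alpha> \<circ> \<sigma>0) {..<n}) \<in> Aut G \<rightarrow> ?B"
    proof
      fix \<alpha> assume \<alpha>: "\<alpha> \<in> Aut G"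
      then have "bij_betw \<alpha> ?V ?V" by (simp add: Aut_def graph_isomorphism_def)
      then have "bij_betw (restrict (\<alpha> \<circ> \<sigma>0) {..<n}) {..<n} ?V"
        using bij_betw_trans[OF b0, of \<alpha> ?V] by simp
      then show "restrict (\<alpha> \<circ> \<sigma>0) {..<n} \<in> ?B"
        using \<alpha> inv2(1) unfolding fibre by (auto simp: orderings_def Aut_def graph_isomorphism_def)
    qed
  next
    show "(\<lambda>\<sigma> v. if v \<in> ?V then \<sigma> (?inv v) else v) \<in> ?B \<rightarrow> Aut G"
    proof
      fix \<sigma> assume \<sigma>: "\<sigma> \<in> ?B"
      let ?\<alpha> = "\<lambda>v. if v \<in> ?V then \<sigma> (?inv v) else v"
      have "bij_betw \<sigma> {..<n} ?V" using \<sigma> by (simp add: orderings_def)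
      then have "bij_betw (\<sigma> \<circ> ?inv) ?V ?V"
        using bij_betw_trans[OF bij_betw_inv_into[OF b0]] by blast
      then have b: "bij_betw ?\<alpha> ?V ?V" by (subst bij_betw_cong[where g = "\<sigma> \<circ> ?inv"]) auto
      then have "?\<alpha> permutes ?V" by (intro bij_imp_permutes) auto
      moreover have "{u, v} \<in> edges G \<longleftrightarrow> {?\<alpha> u, ?\<alpha> v} \<in> edges G" if "u \<in> ?V" "v \<in> ?V" for u v
      proof -
        have "{\<sigma> (?inv u), \<sigma> (?inv v)} \<in> edges G \<longleftrightarrow> {\<sigma>0 (?inv u), \<sigma>0 (?inv v)} \<in> edges G"
          using \<sigma> inv1(1) that unfolding fibre by blast
        then show ?thesis using that by (simp add: inv1)
      qed
      ultimately show "?\<alpha> \<in> Aut G" using b by (simp add: Aut_def graph_isomorphism_def)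
    qed
  next
    fix \<alpha> assume "\<alpha> \<in> Aut G"
    then have "\<alpha> permutes ?V" by (simp add: Aut_def)
    then show "(\<lambda>v. if v \<in> ?V then restrict (\<alpha> \<circ> \<sigma>0) {..<n} (?inv v) else v) = \<alpha>"
      by (auto simp: fun_eq_iff inv1 permutes_not_in)
  next
    fix \<sigma> assume "\<sigma> \<in> ?B"
    then have "\<sigma> \<in> extensional {..<n}" by (simp add: orderings_def)
    then show "restrict ((\<lambda>v. if v \<in> ?V then \<sigma> (?inv v) else v) \<circ> \<sigma>0) {..<n} = \<sigma>"
      by (auto simp: fun_eq_iff inv2 restrict_def extensional_def)
  qed
  then show ?thesis by (simp add: bij_betw_same_card)
qed

lemma finite_Aut: "simple_graph G \<Longrightarrow> finite (Aut G)"
  unfolding Aut_def simple_graph_def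
  by (rule finite_subset[OF _ finite_permutations[of "verts G"]]) auto

lemma card_Aut_pos:
  assumes "simple_graph G"
  shows "card (Aut G) > 0"
proof -
  have "id \<in> Aut G" by (simp add: Aut_def graph_isomorphism_def permutes_id)
  then show ?thesis using finite_Aut[OF assms] card_gt_0_iff by blast
qed

text \<open>The labelled copies of \<open>G\<close> are the values of \<open>relabel\<close>, and the sum over orderings of
  \<open>sum_pmf_relabel\<close> visits each of them \<open>|Aut(G)|\<close> times.\<close>

lemma likelihood_eq:
  assumes G: "simple_graph G"
  shows "likelihood G = F G (verts G) / (fact (card (verts G)) * real (card (Aut G)))"
proof -
  define n where "n = card (verts G)"
  let ?A = "attachment n" and ?O = "orderings n (verts G)"
  let ?R = "relabel G n ` ?O"
  have fin: "finite (verts G)" using G by (simp add: simple_graph_def)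
  then have finO: "finite ?O" by (rule finite_orderings)
  have "likelihood G = measure_pmf.prob ?A ({H. isomorphic H G} \<inter> set_pmf ?A)"
    by (simp add: likelihood_def n_def measure_Int_set_pmf)
  also have "{H. isomorphic H G} \<inter> set_pmf ?A = ?R \<inter> set_pmf ?A"
    using isomorphic_iff_relabel[OF G n_def[symmetric] set_pmf_attachment] by blast
  also have "measure_pmf.prob ?A (?R \<inter> set_pmf ?A) = (\<Sum>H\<in>?R. pmf ?A H)"
    using finO by (simp add: measure_Int_set_pmf measure_measure_pmf_finite)
  finally have L: "likelihood G = (\<Sum>H\<in>?R. pmf ?A H)" .
  have "F G (verts G) / fact n = (\<Sum>\<sigma>\<in>?O. pmf ?A (relabel G n \<sigma>))"
    using sum_pmf_relabel[OF G fin n_def[symmetric]] by simp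
  also have "\<dots> = (\<Sum>H\<in>?R. \<Sum>\<sigma> | \<sigma> \<in> ?O \<and> relabel G n \<sigma> = H. pmf ?A (relabel G n \<sigma>))"
    by (rule sum.image_gen[OF finO])
  also have "\<dots> = (\<Sum>H\<in>?R. real (card (Aut G)) * pmf ?A H)"
  proof (rule sum.cong[OF refl])
    fix H assume "H \<in> ?R"
    then have "card {\<sigma> \<in> ?O. relabel G n \<sigma> = H} = card (Aut G)"
      using card_relabel_fibre[OF G] by blast
    then show "(\<Sum>\<sigma> | \<sigma> \<in> ?O \<and> relabel G n \<sigma> = H. pmf ?A (relabel G n \<sigma>))
        = real (card (Aut G)) * pmf ?A H" by simp
  qed
  also have "\<dots> = real (card (Aut G)) * likelihood G" by (simp add: L sum_distrib_left)
  finally show ?thesis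
    using card_Aut_pos[OF G] by (simp add: n_def field_simps)
qed

section \<open>Counting automorphisms with a permanent\<close>

text \<open>Uniqueness of balanced ternary: modulo \<open>3\<close> only the digit \<open>d 0\<close> survives, and \<open>0\<close> is the only
  multiple of \<open>3\<close> among the admissible digits.\<close>

lemma balanced_ternary_eq_0:
  fixes d :: "nat \<Rightarrow> int"
  assumes "\<And>k. k < N \<Longrightarrow> \<bar>d k\<bar> \<le> 1" "(\<Sum>k<N. d k * 3 ^ k) = 0" "k < N"
  shows "d k = 0"
  using assms
proof (induction N arbitrary: d k)
  case (Suc N)
  have eq: "d 0 + 3 * (\<Sum>k<N. d (Suc k) * 3 ^ k) = 0"
    using Suc.prems(2) by (subst (asm) sum.lessThan_Suc_shift) (simp add: sum_distrib_left mult_ac)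
  then have "3 dvd d 0" by presburger
  moreover have "\<bar>d 0\<bar> \<le> 1" using Suc.prems(1) by simp
  ultimately have d0: "d 0 = 0" by presburger
  with eq have "(\<Sum>k<N. d (Suc k) * 3 ^ k) = 0" by simp
  then have "d (Suc i) = 0" if "i < N" for i
    using Suc.IH[of "\<lambda>k. d (Suc k)" i, OF Suc.prems(1)] that by fastforce
  with d0 show ?case using Suc.prems(3) by (cases k) auto
qed simp

text \<open>The entry in row \<open>i\<close> and column \<open>j\<close> serves as the digit at position \<open>i * n + j\<close>.\<close>

lemma balanced_ternary_matrix_eq_0:
  fixes d :: "nat \<Rightarrow> nat \<Rightarrow> int"
  assumes "\<And>i j. i < n \<Longrightarrow> j < n \<Longrightarrow> \<bar>d i j\<bar> \<le> 1"
    and "(\<Sum>i<n. \<Sum>j<n. d i j * 3 ^ (i * n + j)) = 0" "i < n" "j < n"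
  shows "d i j = 0"
proof -
  let ?d = "\<lambda>k. d (k div n) (k mod n)"
  have "(\<Sum>k<n * n. ?d k * 3 ^ k) = (\<Sum>i<n. \<Sum>k\<in>{i * n..<i * n + n}. ?d k * 3 ^ k)"
    using sum.nat_group[of "\<lambda>k. ?d k * 3 ^ k" n n] by simp
  also have "\<dots> = (\<Sum>i<n. \<Sum>j<n. d i j * 3 ^ (i * n + j))"
  proof (rule sum.cong[OF refl])
    fix i
    show "(\<Sum>k\<in>{i * n..<i * n + n}. ?d k * 3 ^ k) = (\<Sum>j<n. d i j * 3 ^ (i * n + j))"
    proof (rule sum.reindex_bij_witness[where j = "\<lambda>k. k - i * n" and i = "\<lambda>j. i * n + j"])
      fix k assume "k \<in> {i * n..<i * n + n}"
      then obtain j where "k = i * n + j" "j < n"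
        by (metis add_less_cancel_left atLeastLessThan_iff le_Suc_ex)
      then show "d i (k - i * n) * 3 ^ (i * n + (k - i * n)) = ?d k * 3 ^ k" by simp
    qed auto
  qed
  finally have "(\<Sum>k<n * n. ?d k * 3 ^ k) = 0" using assms(2) by simp
  moreover have "\<bar>?d k\<bar> \<le> 1" if "k < n * n" for k
  proof (rule assms(1))
    show "k div n < n" using that by (simp add: less_mult_imp_div_less)
    show "k mod n < n" using that by (cases n) auto
  qed
  moreover have "i * n + j < n * n"
  proof -
    have "i * n + j < Suc i * n" using assms(4) by simp
    also have "Suc i * n \<le> n * n" using assms(3) by (intro mult_le_mono1) simp
    finally show ?thesis .
  qed
  ultimately have "?d (i * n + j) = 0" by (intro balanced_ternary_eq_0[of "n * n" ?d])
  then show ?thesis using assms(4) by simp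
qed

text \<open>The terms with negative exponent are at most \<open>1/x\<close> each and there are fewer than \<open>x\<close> of them, so
  together they stay below \<open>1\<close> and the integer part removes exactly these terms.\<close>

lemma floor_sum_powi:
  fixes e :: "'b \<Rightarrow> int"
  assumes "finite A" "card A < x"
  shows "\<lfloor>\<Sum>s\<in>A. (of_nat x :: rat) powi e s\<rfloor> = (\<Sum>s | s \<in> A \<and> e s \<ge> 0. int x ^ nat (e s))"
proof -
  let ?P = "{s. s \<in> A \<and> e s \<ge> 0}" and ?N = "{s. s \<in> A \<and> \<not> e s \<ge> 0}"
  let ?f = "\<lambda>s. (of_nat x :: rat) powi e s"
  have x: "(of_nat x :: rat) > 0" using assms(2) by simp
  have "sum ?f A = sum ?f (?P \<union> ?N)" by (rule arg_cong[where f = "sum ?f"]) blast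
  also have "\<dots> = sum ?f ?P + sum ?f ?N"
    using assms(1) by (intro sum.union_disjoint) auto
  also have "sum ?f ?P = of_int (\<Sum>s\<in>?P. int x ^ nat (e s))"
    by (simp add: power_int_def)
  finally have eq: "sum ?f A = of_int (\<Sum>s\<in>?P. int x ^ nat (e s)) + sum ?f ?N" .
  have "sum ?f ?N \<ge> 0" using x by (intro sum_nonneg) simp
  moreover have "sum ?f ?N < 1"
  proof -
    have "?f s \<le> 1 / of_nat x" if "s \<in> ?N" for s
    proof -
      have "(of_nat x :: rat) powi e s \<le> of_nat x powi (- 1)"
        using that assms(2) by (intro power_int_increasing) auto
      then show ?thesis by (simp add: field_simps)
    qed
    then have "sum ?f ?N \<le> of_nat (card ?N) * (1 / of_nat x)"
      by (intro sum_bounded_above) auto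
    also have "\<dots> < 1"
    proof -
      have "card ?N \<le> card A" using assms(1) by (intro card_mono) auto
      then have "card ?N < x" using assms(2) by simp
      then show ?thesis using x by simp
    qed
    finally show ?thesis .
  qed
  ultimately show ?thesis unfolding eq by (intro floor_unique) auto
qed

text \<open>The coefficients of \<open>z\<close>, read as a Laurent polynomial in \<open>x\<close>, count the \<open>s\<close> with a given exponent and
  are less than \<open>x\<close>. The integer part of \<open>z\<close> keeps the terms of exponent at least \<open>0\<close>, and \<open>x\<close> times
  that of \<open>z / x\<close> keeps those of exponent at least \<open>1\<close>.\<close>

lemma constant_coeff_eq:
  fixes e :: "'b \<Rightarrow> int" and x :: nat
  assumes "finite A" "card A < x"
  defines "z \<equiv> \<Sum>s\<in>A. (of_nat x :: rat) powi e s"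
  shows "\<lfloor>z\<rfloor> - int x * \<lfloor>z / of_nat x\<rfloor> = int (card {s \<in> A. e s = 0})"
proof -
  have x: "(of_nat x :: rat) \<noteq> 0" using assms(2) by simp
  have "z / of_nat x = (\<Sum>s\<in>A. of_nat x powi (e s - 1))"
    using x by (simp add: z_def sum_divide_distrib power_int_diff)
  then have "int x * \<lfloor>z / of_nat x\<rfloor> = (\<Sum>s | s \<in> A \<and> e s - 1 \<ge> 0. int x * int x ^ nat (e s - 1))"
    by (simp only: floor_sum_powi[OF assms(1,2)] sum_distrib_left)
  also have "\<dots> = (\<Sum>s | s \<in> A \<and> e s \<ge> 1. int x ^ nat (e s))"
  proof (rule sum.cong)
    fix s assume "s \<in> {s. s \<in> A \<and> e s \<ge> 1}"
    then have "nat (e s) = Suc (nat (e s - 1))" by auto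
    then show "int x * int x ^ nat (e s - 1) = int x ^ nat (e s)" by simp
  qed auto
  finally have 1: "int x * \<lfloor>z / of_nat x\<rfloor> = (\<Sum>s | s \<in> A \<and> e s \<ge> 1. int x ^ nat (e s))" .
  have "{s. s \<in> A \<and> e s \<ge> 0} = {s. s \<in> A \<and> e s \<ge> 1} \<union> {s \<in> A. e s = 0}" by auto
  then have "\<lfloor>z\<rfloor> = (\<Sum>s | s \<in> A \<and> e s \<ge> 1. int x ^ nat (e s)) + (\<Sum>s \<in> {s \<in> A. e s = 0}. int x ^ nat (e s))"
    unfolding z_def floor_sum_powi[OF assms(1,2)]
    using assms(1) by (simp only:) (intro sum.union_disjoint, auto)
  with 1 show ?thesis by simp
qed

lemma card_orderings:
  assumes "finite S" "card S = t"
  shows "card (orderings t S) = fact t"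
  using assms
proof (induction t arbitrary: S)
  case 0
  then have "S = {}" by simp
  then show ?case by (simp add: orderings_0)
next
  case (Suc t)
  have "card (orderings (Suc t) S) = (\<Sum>v\<in>S. \<Sum>\<sigma>\<in>orderings t (S - {v}). 1)"
    using sum_orderings_Suc[OF Suc.prems(1), of "\<lambda>_. 1::nat" t] by simp
  also have "\<dots> = (\<Sum>v\<in>S. fact t)"
    using Suc by (intro sum.cong) simp_all
  finally show ?case using Suc.prems by simp
qed

text \<open>For \<open>S = {..<n}\<close> this is the permanent of \<open>w\<close>; in general it is the permanent of the submatrix of
  the first \<open>card S\<close> rows and the columns in \<open>S\<close>.\<close>

definition perm_sum :: "(nat \<Rightarrow> 'a \<Rightarrow> 'b::comm_semiring_1) \<Rightarrow> 'a set \<Rightarrow> 'b" where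
  "perm_sum w S = (\<Sum>\<sigma>\<in>orderings (card S) S. \<Prod>u<card S. w u (\<sigma> u))"

lemma perm_sum_empty: "perm_sum w {} = 1"
  by (simp add: perm_sum_def orderings_0)

text \<open>Laplace expansion along the last of these rows.\<close>

lemma perm_sum_rec:
  assumes "finite S" "S \<noteq> {}"
  shows "perm_sum w S = (\<Sum>v\<in>S. perm_sum w (S - {v}) * w (card S - 1) v)"
proof -
  obtain t where t: "card S = Suc t" using assms by (metis card_gt_0_iff gr0_implies_Suc)
  have "perm_sum w S = (\<Sum>v\<in>S. \<Sum>\<sigma>\<in>orderings t (S - {v}). \<Prod>u<Suc t. w u ((\<sigma>(t := v)) u))"
    unfolding perm_sum_def t by (rule sum_orderings_Suc[OF assms(1)])
  also have "\<dots> = (\<Sum>v\<in>S. (\<Sum>\<sigma>\<in>orderings t (S - {v}). \<Prod>u<t. w u (\<sigma> u)) * w t v)"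
    unfolding sum_distrib_right by (intro sum.cong refl) (simp add: prod.lessThan_Suc)
  finally show ?thesis using t assms by (simp add: perm_sum_def)
qed

definition adj :: "nat graph \<Rightarrow> nat \<Rightarrow> nat \<Rightarrow> nat" where
  "adj G u v = (if {u, v} \<in> edges G then 1 else 0)"

text \<open>For the matrix unit \<open>E\<close> with its one at \<open>(u, v)\<close> and the adjacency matrix \<open>A\<close>, this is the number whose
  balanced ternary digits are the entries of \<open>EA - AE\<close>: row \<open>u\<close> of \<open>EA\<close> is row \<open>v\<close> of \<open>A\<close>, and column \<open>v\<close> of
  \<open>AE\<close> is column \<open>u\<close> of \<open>A\<close>.\<close>

definition commutator_weight :: "nat \<Rightarrow> nat graph \<Rightarrow> nat \<Rightarrow> nat \<Rightarrow> int" where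
  "commutator_weight n G u v =
     (\<Sum>j<n. int (adj G v j) * 3 ^ (u * n + j) - int (adj G j u) * 3 ^ (j * n + v))"

text \<open>The encoding is additive, so summing over the matrix units that make up the permutation matrix
  \<open>P\<close> encodes \<open>PA - AP\<close>. The inverse of \<open>\<sigma>\<close> enters because \<open>AP\<close> permutes the columns of \<open>A\<close>.\<close>

lemma sum_commutator_weight:
  assumes \<sigma>: "bij_betw \<sigma> {..<n} {..<n}"
  shows "(\<Sum>u<n. commutator_weight n G u (\<sigma> u)) =
    (\<Sum>u<n. \<Sum>j<n. (int (adj G (\<sigma> u) j) - int (adj G u (inv_into {..<n} \<sigma> j))) * 3 ^ (u * n + j))"
proof -
  let ?\<tau> = "inv_into {..<n} \<sigma>"
  have "(\<Sum>u<n. int (adj G j u) * 3 ^ (j * n + \<sigma> u)) = (\<Sum>v<n. int (adj G j (?\<tau> v)) * 3 ^ (j * n + v))"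
    for j
  proof -
    let ?g = "\<lambda>v. int (adj G j (?\<tau> v)) * 3 ^ (j * n + v)"
    have "(\<Sum>u<n. int (adj G j u) * 3 ^ (j * n + \<sigma> u)) = (\<Sum>u<n. ?g (\<sigma> u))"
      by (intro sum.cong) (auto simp: bij_betw_inv_into_left[OF \<sigma>])
    also have "\<dots> = sum ?g {..<n}" by (rule sum.reindex_bij_betw[OF \<sigma>])
    finally show ?thesis .
  qed
  then have "(\<Sum>u<n. \<Sum>j<n. int (adj G j u) * 3 ^ (j * n + \<sigma> u)) =
      (\<Sum>j<n. \<Sum>v<n. int (adj G j (?\<tau> v)) * 3 ^ (j * n + v))"
    by (subst sum.swap) simp
  then show ?thesis
    by (simp add: commutator_weight_def sum_subtractf algebra_simps)
qed

text \<open>The sum vanishes exactly if \<open>PA = AP\<close>; substituting \<open>j = \<sigma> v\<close> in the entries turns this into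
  preservation of adjacency.\<close>

lemma sum_commutator_weight_eq_0_iff:
  assumes \<sigma>: "bij_betw \<sigma> {..<n} {..<n}"
  shows "(\<Sum>u<n. commutator_weight n G u (\<sigma> u)) = 0 \<longleftrightarrow>
    (\<forall>u<n. \<forall>v<n. {\<sigma> u, \<sigma> v} \<in> edges G \<longleftrightarrow> {u, v} \<in> edges G)"
proof -
  let ?\<tau> = "inv_into {..<n} \<sigma>"
  let ?d = "\<lambda>u j. int (adj G (\<sigma> u) j) - int (adj G u (?\<tau> j))"
  have "(\<Sum>u<n. \<Sum>j<n. ?d u j * 3 ^ (u * n + j)) = 0 \<longleftrightarrow> (\<forall>u<n. \<forall>j<n. ?d u j = 0)"
  proof
    assume "(\<Sum>u<n. \<Sum>j<n. ?d u j * 3 ^ (u * n + j)) = 0"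
    then show "\<forall>u<n. \<forall>j<n. ?d u j = 0"
      by (intro allI impI balanced_ternary_matrix_eq_0[of n ?d]) (auto simp: adj_def)
  qed simp
  also have "\<dots> \<longleftrightarrow> (\<forall>u<n. \<forall>v<n. ?d u (\<sigma> v) = 0)"
  proof -
    have "\<sigma> v < n" "?\<tau> v < n" "\<sigma> (?\<tau> v) = v" if "v < n" for v
      using that bij_betw_apply[OF \<sigma>] bij_betw_apply[OF bij_betw_inv_into[OF \<sigma>]]
        bij_betw_inv_into_right[OF \<sigma>] by auto
    then show ?thesis by metis
  qed
  also have "\<dots> \<longleftrightarrow> (\<forall>u<n. \<forall>v<n. {\<sigma> u, \<sigma> v} \<in> edges G \<longleftrightarrow> {u, v} \<in> edges G)"
    using bij_betw_inv_into_left[OF \<sigma>] by (auto simp: adj_def split: if_splits)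
  finally show ?thesis unfolding sum_commutator_weight[OF \<sigma>] .
qed

text \<open>The value of the permanent is a sum of \<open>n!\<close> powers of \<open>x\<close>, one for each permutation, and the
  automorphisms are the permutations with exponent \<open>0\<close>. The choice of \<open>x\<close> exceeds the number of terms.\<close>

lemma card_Aut_eq_floor:
  assumes G: "simple_graph G" "verts G = {..<n}"
  defines "x \<equiv> fact n + 1"
  defines "z \<equiv> perm_sum (\<lambda>u v. (of_nat x :: rat) powi commutator_weight n G u v) {..<n}"
  shows "of_nat (card (Aut G)) = (of_int \<lfloor>z\<rfloor> - of_nat x * of_int \<lfloor>z / of_nat x\<rfloor> :: rat)"
proof -
  let ?O = "orderings n {..<n}"
  let ?e = "\<lambda>\<sigma>. \<Sum>u<n. commutator_weight n G u (\<sigma> u)"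
  let ?id = "restrict id {..<n}"
  have "x \<noteq> 0" unfolding x_def by linarith
  then have x: "of_nat x \<noteq> (0 :: rat)" by (simp only: of_nat_eq_0_iff not_False_eq_True)
  have z: "z = (\<Sum>\<sigma>\<in>?O. of_nat x powi ?e \<sigma>)"
  proof -
    have "(\<Prod>u\<in>A. (of_nat x :: rat) powi f u) = of_nat x powi sum f A" if "finite A" for A :: "nat set" and f
      using that by induction (simp_all add: power_int_add[OF disjI1[OF x]])
    then show ?thesis by (simp add: z_def perm_sum_def)
  qed
  have id: "?id \<in> orderings n (verts G)"
    using bij_betw_id[of "{..<n}"] by (auto simp: orderings_def G(2) id_def)
  have "{\<sigma> \<in> ?O. ?e \<sigma> = 0} = {\<sigma> \<in> orderings n (verts G). relabel G n \<sigma> = relabel G n ?id}"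
  proof (intro Collect_cong conj_cong)
    fix \<sigma> assume "\<sigma> \<in> orderings n (verts G)"
    then show "?e \<sigma> = 0 \<longleftrightarrow> relabel G n \<sigma> = relabel G n ?id"
      unfolding relabel_eq_iff[OF G(1) \<open>\<sigma> \<in> _\<close> id]
      by (subst sum_commutator_weight_eq_0_iff) (auto simp: orderings_def G(2))
  qed (simp add: G(2))
  then have "card (Aut G) = card {\<sigma> \<in> ?O. ?e \<sigma> = 0}"
    using card_relabel_fibre[OF G(1) id] by simp
  also have "int \<dots> = \<lfloor>z\<rfloor> - int x * \<lfloor>z / of_nat x\<rfloor>"
    unfolding z by (rule constant_coeff_eq[symmetric]) (auto simp: finite_orderings card_orderings x_def)
  finally have "of_int (int (card (Aut G))) = (of_int (\<lfloor>z\<rfloor> - int x * \<lfloor>z / of_nat x\<rfloor>) :: rat)"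
    by simp
  then show ?thesis by simp
qed

section \<open>Reasoning about programs and their cost\<close>

text \<open>Total correctness with the cost as an argument of the postcondition. Since execution is
  deterministic, the weakest preconditions below are equations and can be used for rewriting.\<close>

definition wp :: "nat \<Rightarrow> prog \<Rightarrow> state \<Rightarrow> (nat \<Rightarrow> state \<Rightarrow> bool) \<Rightarrow> bool" where
  "wp m p \<sigma> Q \<longleftrightarrow> (\<exists>k \<sigma>'. exec m p \<sigma> k \<sigma>' \<and> Q k \<sigma>')"

lemma wp_mono:
  "wp m p \<sigma> Q \<Longrightarrow> (\<And>k \<sigma>'. Q k \<sigma>' \<Longrightarrow> R k \<sigma>') \<Longrightarrow> wp m p \<sigma> R"
  unfolding wp_def by blast

lemma wp_deterministic: "exec m p \<sigma> k \<sigma>' \<Longrightarrow> wp m p \<sigma> Q \<longleftrightarrow> Q k \<sigma>'"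
  unfolding wp_def by (metis exec_deterministic)

lemma wp_Skip: "wp m Skip \<sigma> Q \<longleftrightarrow> Q 1 \<sigma>"
  by (rule wp_deterministic[OF exec.Skip])

lemma wp_Assign: "wp m (Assign x a) (s, h) Q \<longleftrightarrow> Q (acost a + 1) (s(x := aval a s), h)"
  by (rule wp_deterministic[OF exec.Assign])

lemma wp_Load:
  assumes "aval a s = of_nat i" "i < m"
  shows "wp m (Load x a) (s, h) Q \<longleftrightarrow> Q (acost a + 1) (s(x := h i), h)"
  by (rule wp_deterministic[OF exec.Load[OF assms]])

lemma wp_Store:
  assumes "aval a s = of_nat i" "i < m"
  shows "wp m (Store a b) (s, h) Q \<longleftrightarrow> Q (acost a + acost b + 1) (s, h(i := aval b s))"
  by (rule wp_deterministic[OF exec.Store[OF assms]])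

lemma wp_Seq: "wp m (Seq p q) \<sigma> Q \<longleftrightarrow> wp m p \<sigma> (\<lambda>k \<sigma>'. wp m q \<sigma>' (\<lambda>l. Q (k + l)))"
proof
  assume "wp m (Seq p q) \<sigma> Q"
  then obtain k \<sigma>' where "exec m (Seq p q) \<sigma> k \<sigma>'" "Q k \<sigma>'" unfolding wp_def by blast
  then show "wp m p \<sigma> (\<lambda>k \<sigma>'. wp m q \<sigma>' (\<lambda>l. Q (k + l)))"
    unfolding wp_def by (elim SeqE) blast
next
  assume "wp m p \<sigma> (\<lambda>k \<sigma>'. wp m q \<sigma>' (\<lambda>l. Q (k + l)))"
  then show "wp m (Seq p q) \<sigma> Q" unfolding wp_def using exec.Seq by blast
qed

lemma wp_IfLess:
  "wp m (IfLess a b p q) (s, h) Q \<longleftrightarrow>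
    (if aval a s < aval b s then wp m p (s, h) (\<lambda>k. Q (acost a + acost b + 1 + k))
     else wp m q (s, h) (\<lambda>k. Q (acost a + acost b + 1 + k)))"
proof (cases "aval a s < aval b s")
  case True
  have "wp m (IfLess a b p q) (s, h) Q \<longleftrightarrow> wp m p (s, h) (\<lambda>k. Q (acost a + acost b + 1 + k))"
  proof
    assume "wp m (IfLess a b p q) (s, h) Q"
    then obtain k \<sigma>' where "exec m (IfLess a b p q) (s, h) k \<sigma>'" "Q k \<sigma>'" unfolding wp_def by blast
    then show "wp m p (s, h) (\<lambda>k. Q (acost a + acost b + 1 + k))"
      unfolding wp_def by (elim IfE) (use True in \<open>auto simp del: split_paired_Ex\<close>)
  next
    assume "wp m p (s, h) (\<lambda>k. Q (acost a + acost b + 1 + k))"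
    then show "wp m (IfLess a b p q) (s, h) Q" unfolding wp_def using exec.IfTrue[OF True] by blast
  qed
  with True show ?thesis by simp
next
  case False
  have "wp m (IfLess a b p q) (s, h) Q \<longleftrightarrow> wp m q (s, h) (\<lambda>k. Q (acost a + acost b + 1 + k))"
  proof
    assume "wp m (IfLess a b p q) (s, h) Q"
    then obtain k \<sigma>' where "exec m (IfLess a b p q) (s, h) k \<sigma>'" "Q k \<sigma>'" unfolding wp_def by blast
    then show "wp m q (s, h) (\<lambda>k. Q (acost a + acost b + 1 + k))"
      unfolding wp_def by (elim IfE) (use False in \<open>auto simp del: split_paired_Ex\<close>)
  next
    assume "wp m q (s, h) (\<lambda>k. Q (acost a + acost b + 1 + k))"
    then show "wp m (IfLess a b p q) (s, h) Q" unfolding wp_def using exec.IfFalse[OF False] by blast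
  qed
  with False show ?thesis by simp
qed

primrec written :: "prog \<Rightarrow> string set" where
  "written Skip = {}"
| "written (Assign x a) = {x}"
| "written (Load x a) = {x}"
| "written (Store a b) = {}"
| "written (Seq p q) = written p \<union> written q"
| "written (IfLess a b p q) = written p \<union> written q"
| "written (WhileLess a b p) = written p"

primrec stores :: "prog \<Rightarrow> bool" where
  "stores Skip = False"
| "stores (Assign x a) = False"
| "stores (Load x a) = False"
| "stores (Store a b) = True"
| "stores (Seq p q) = (stores p \<or> stores q)"
| "stores (IfLess a b p q) = (stores p \<or> stores q)"
| "stores (WhileLess a b p) = stores p"

text \<open>Loop invariants only have to mention what the loop changes; everything else is carried over by
  this syntactic frame property.\<close>

lemma exec_frame:
  "exec m p \<sigma> k \<sigma>' \<Longrightarrow> (\<forall>z. z \<notin> written p \<longrightarrow> fst \<sigma>' z = fst \<sigma> z) \<and> (\<not> stores p \<longrightarrow> snd \<sigma>' = snd \<sigma>)"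
  by (induction rule: exec.induct) auto

lemma wp_frame:
  assumes "wp m p (s, h) Q"
    and "\<And>k s' h'. Q k (s', h') \<Longrightarrow> (\<And>z. z \<notin> written p \<Longrightarrow> s' z = s z) \<Longrightarrow>
      (\<not> stores p \<Longrightarrow> h' = h) \<Longrightarrow> R k (s', h')"
  shows "wp m p (s, h) R"
proof -
  obtain k s' h' where *: "exec m p (s, h) k (s', h')" "Q k (s', h')"
    using assms(1) unfolding wp_def split_paired_Ex by blast
  have "R k (s', h')" using *(2) exec_frame[OF *(1)] by (intro assms(2)) auto
  with * show ?thesis unfolding wp_def by blast
qed

definition For :: "string \<Rightarrow> string \<Rightarrow> prog \<Rightarrow> prog" where
  "For x y p = Seq (Assign x (Const 0))
     (WhileLess (Var x) (Var y) (Seq p (Assign x (Add (Var x) (Const 1)))))"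

lemma written_For [simp]: "written (For x y p) = insert x (written p)"
  by (auto simp: For_def)

lemma stores_For [simp]: "stores (For x y p) = stores p"
  by (auto simp: For_def)

text \<open>Each iteration adds to the cost \<open>K\<close> of the body \<open>3\<close> units for the comparison and \<open>4\<close> for the
  increment; the initialization and the final comparison cost \<open>5\<close> units. The frame property is built
  into the premises for the body and for the exit.\<close>

lemma wp_For:
  assumes bound: "s y = of_nat N" "y \<notin> insert x (written p)"
    and init: "I 0 (s(x := 0)) h"
    and step: "\<And>i s' h'. i < N \<Longrightarrow> I i s' h' \<Longrightarrow> s' x = of_nat i \<Longrightarrow>
      (\<And>z. z \<notin> insert x (written p) \<Longrightarrow> s' z = s z) \<Longrightarrow> (\<not> stores p \<Longrightarrow> h' = h) \<Longrightarrow>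
      wp m p (s', h') (\<lambda>k (s'', h''). k \<le> K \<and> I (Suc i) (s''(x := s'' x + 1)) h'' \<and> s'' x = of_nat i)"
    and final: "\<And>k s' h'. k \<le> N * (K + 7) + 5 \<Longrightarrow> I N s' h' \<Longrightarrow> s' x = of_nat N \<Longrightarrow>
      (\<And>z. z \<notin> insert x (written p) \<Longrightarrow> s' z = s z) \<Longrightarrow> (\<not> stores p \<Longrightarrow> h' = h) \<Longrightarrow> Q k (s', h')"
  shows "wp m (For x y p) (s, h) Q"
proof -
  let ?body = "Seq p (Assign x (Add (Var x) (Const 1)))"
  let ?loop = "WhileLess (Var x) (Var y) ?body"
  let ?frame = "\<lambda>s' h'. (\<forall>z. z \<notin> insert x (written p) \<longrightarrow> s' z = s z) \<and> (\<not> stores p \<longrightarrow> h' = h)"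
  have loop: "\<exists>k s'' h''. exec m ?loop (s', h') k (s'', h'') \<and> k \<le> (N - i) * (K + 7) + 3 \<and>
      I N s'' h'' \<and> s'' x = of_nat N \<and> ?frame s'' h''"
    if "i \<le> N" "I i s' h'" "s' x = of_nat i" "?frame s' h'" for i s' h'
    using that
  proof (induction "N - i" arbitrary: i s' h')
    case 0
    then have "i = N" by simp
    have "s' y = s y" using 0(5) bound(2) by blast
    then have "exec m ?loop (s', h') (acost (Var x) + acost (Var y) + 1) (s', h')"
      using 0 bound(1) by (intro exec.WhileFalse) simp
    then have "exec m ?loop (s', h') 3 (s', h')" by (simp add: eval_nat_numeral)
    moreover have "I N s' h'" "s' x = of_nat N" using 0 \<open>i = N\<close> by simp_all
    ultimately show ?case using 0(5) by (intro exI[of _ 3] exI[of _ s'] exI[of _ h']) simp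
  next
    case (Suc d)
    then have i: "i < N" by simp
    have y: "s' y = of_nat N" using Suc.prems(4) bound by metis
    have "wp m p (s', h') (\<lambda>k (s'', h''). k \<le> K \<and> I (Suc i) (s''(x := s'' x + 1)) h'' \<and> s'' x = of_nat i)"
      using Suc.prems i by (intro step) auto
    then obtain k s1 h1 where p: "exec m p (s', h') k (s1, h1)" "k \<le> K"
      "I (Suc i) (s1(x := s1 x + 1)) h1" "s1 x = of_nat i"
      unfolding wp_def split_paired_Ex prod.case by blast
    let ?s2 = "s1(x := aval (Add (Var x) (Const 1)) s1)"
    have body: "exec m ?body (s', h') (k + (acost (Add (Var x) (Const 1)) + 1)) (?s2, h1)"
      by (rule exec.Seq[OF p(1) exec.Assign])
    have fr: "?frame ?s2 h1"
      using exec_frame[OF p(1)] Suc.prems(4) by auto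
    have "\<exists>k s'' h''. exec m ?loop (?s2, h1) k (s'', h'') \<and> k \<le> (N - Suc i) * (K + 7) + 3 \<and>
      I N s'' h'' \<and> s'' x = of_nat N \<and> ?frame s'' h''"
      using Suc.hyps(2) i p fr by (intro Suc.hyps(1)) auto
    then obtain l s3 h3 where l: "exec m ?loop (?s2, h1) l (s3, h3)" "l \<le> (N - Suc i) * (K + 7) + 3"
      "I N s3 h3" "s3 x = of_nat N" "?frame s3 h3" by blast
    have "exec m ?loop (s', h') (acost (Var x) + acost (Var y) + 1 + (k + (acost (Add (Var x) (Const 1)) + 1)) + l) (s3, h3)"
      using i y Suc.prems(3) by (intro exec.WhileTrue[OF _ body l(1)]) simp
    moreover have "acost (Var x) + acost (Var y) + 1 + (k + (acost (Add (Var x) (Const 1)) + 1)) + l \<le> (N - i) * (K + 7) + 3"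
    proof -
      have "N - i = Suc (N - Suc i)" using i by simp
      then show ?thesis using p(2) l(2) by simp
    qed
    ultimately show ?case using l by blast
  qed
  have "\<exists>k s' h'. exec m ?loop (s(x := 0), h) k (s', h') \<and> k \<le> (N - 0) * (K + 7) + 3 \<and>
      I N s' h' \<and> s' x = of_nat N \<and> ?frame s' h'"
    using init by (intro loop) auto
  then obtain k s' h' where *: "exec m ?loop (s(x := 0), h) k (s', h')" "k \<le> (N - 0) * (K + 7) + 3"
    "I N s' h'" "s' x = of_nat N" "?frame s' h'"
    by blast
  have "exec m (Assign x (Const 0)) (s, h) (acost (Const 0) + 1) (s(x := 0), h)"
    using exec.Assign[of m x "Const 0" s h] by simp
  then have "exec m (For x y p) (s, h) (acost (Const 0) + 1 + k) (s', h')"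
    unfolding For_def using *(1) by (rule exec.Seq)
  moreover have "Q (acost (Const 0) + 1 + k) (s', h')"
    using * by (intro final) auto
  ultimately show ?thesis unfolding wp_def by blast
qed

text \<open>Memory \<open>h\<close> after the \<open>i\<close> cells from address \<open>b\<close> on have been overwritten by \<open>f 0, \<dots>, f (i - 1)\<close>.
  Every table is written from its first to its last cell, so with \<open>fill\<close> the memory is always known
  exactly.\<close>

definition fill :: "(nat \<Rightarrow> rat) \<Rightarrow> nat \<Rightarrow> nat \<Rightarrow> (nat \<Rightarrow> rat) \<Rightarrow> nat \<Rightarrow> rat" where
  "fill h b i f = (\<lambda>a. if b \<le> a \<and> a < b + i then f (a - b) else h a)"

lemma fill_0 [simp]: "fill h b 0 f = h"
  by (auto simp: fill_def)

lemma fill_Suc: "(fill h b i f)(b + i := f i) = fill h b (Suc i) f"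
  by (auto simp: fill_def fun_eq_iff)

lemma fill_inside: "i < N \<Longrightarrow> fill h b N f (b + i) = f i"
  by (simp add: fill_def)

lemma fill_below: "a < b \<Longrightarrow> fill h b N f a = h a"
  by (simp add: fill_def)

text \<open>The memory is divided into blocks of \<open>q = n\<^sup>2\<close> cells: the input in block \<open>0\<close>, factorials in block \<open>1\<close>,
  packed adjacency rows in block \<open>2\<close>, powers of \<open>x\<close> in block \<open>3\<close>, and the matrix whose permanent is
  taken in block \<open>4\<close>. The two tables over subsets start at \<open>5q\<close> and \<open>5q + 2\<^sup>n\<close>.\<close>

definition block :: "rat \<Rightarrow> aexp \<Rightarrow> aexp" where
  "block c a = Add (Mul (Const c) (Var ''q'')) a"

lemma aval_block [simp]: "aval (block c a) s = c * s ''q'' + aval a s"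
  by (simp add: block_def)

lemma acost_block [simp]: "acost (block c a) = acost a + 4"
  by (simp add: block_def)

abbreviation seq_notation :: "prog \<Rightarrow> prog \<Rightarrow> prog" (infixr \<open>;;\<close> 60) where
  "p ;; q \<equiv> Seq p q"

lemmas wp_straight = wp_Seq wp_Assign wp_IfLess wp_Skip

section \<open>The tables of polynomial size\<close>

definition factorials :: prog where
  "factorials =
     Assign ''f'' (Const 1) ;; Assign ''N'' (Const 1) ;;
     For ''i'' ''n''
       (Store (block 1 (Var ''i'')) (Var ''f'') ;;
        Assign ''f'' (Mul (Var ''f'') (Add (Var ''i'') (Const 1))) ;;
        Assign ''N'' (Add (Var ''N'') (Var ''N'')))"

lemma wp_factorials:
  assumes s: "s ''n'' = of_nat n" "s ''q'' = of_nat (n * n)" and m: "n * n + n \<le> m"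
  shows "wp m factorials (s, h) (\<lambda>k (s', h'). k \<le> 100 * n + 100 \<and> s' ''f'' = fact n \<and>
    s' ''N'' = 2 ^ n \<and> h' = fill h (n * n) n fact)"
  unfolding factorials_def wp_straight
  apply (rule wp_For[where N = n and K = 50 and I = "\<lambda>i s' h'. s' ''f'' = fact i \<and> s' ''N'' = 2 ^ i \<and>
      h' = fill h (n * n) i fact"])
  subgoal using s by simp
  subgoal by simp
  subgoal by simp
  subgoal for i s' h'
    using s m
    by (simp add: wp_straight wp_Store[where i = "n * n + i"] fill_Suc[symmetric] algebra_simps)
  subgoal for k s' h'
    by simp
  done

text \<open>A row of the adjacency matrix as the digits of one number in base \<open>n\<close>.\<close>

definition packed_row :: "nat \<Rightarrow> nat graph \<Rightarrow> nat \<Rightarrow> nat" where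
  "packed_row n G u = (\<Sum>v<n. adj G u v * n ^ v)"

definition rows :: prog where
  "rows =
     For ''u'' ''n''
       (Assign ''r'' (Const 0) ;; Assign ''p'' (Const 1) ;;
        For ''v'' ''n''
          (Load ''a'' (Add (Mul (Var ''u'') (Var ''n'')) (Var ''v'')) ;;
           Assign ''r'' (Add (Var ''r'') (Mul (Var ''a'') (Var ''p''))) ;;
           Assign ''p'' (Mul (Var ''p'') (Var ''n''))) ;;
        Store (block 2 (Var ''u'')) (Var ''r''))"

lemma matrix_index_less: "i < n \<Longrightarrow> j < n \<Longrightarrow> i * n + j < n * (n :: nat)"
proof -
  assume "i < n" "j < n"
  then have "i * n + j < Suc i * n" by simp
  also have "Suc i * n \<le> n * n" using \<open>i < n\<close> by (intro mult_le_mono1) simp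
  finally show ?thesis .
qed

lemma wp_rows:
  assumes s: "s ''n'' = of_nat n" "s ''q'' = of_nat (n * n)" and m: "3 * (n * n) \<le> m"
    and h: "\<And>u v. u < n \<Longrightarrow> v < n \<Longrightarrow> h (u * n + v) = of_nat (adj G u v)"
  shows "wp m rows (s, h) (\<lambda>k (s', h'). k \<le> 200 * (n * n) + 100 * n + 100 \<and>
    h' = fill h (2 * (n * n)) n (\<lambda>u. of_nat (packed_row n G u)))"
proof -
  let ?fill = "\<lambda>i. fill h (2 * (n * n)) i (\<lambda>u. of_nat (packed_row n G u))"
  show ?thesis
    unfolding rows_def
  proof (rule wp_For[where N = n and K = "n * 57 + 50" and I = "\<lambda>i s' h'. h' = ?fill i"],
      goal_cases bound written init step final)
    case (step u s1 h1)
    have nn: "n \<le> n * n" by simp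
    show ?case
      unfolding wp_Seq wp_Assign
    proof (rule wp_For[where N = n and K = 50 and I = "\<lambda>v s' h'. s' ''p'' = of_nat (n ^ v) \<and>
          s' ''r'' = of_nat (\<Sum>x<v. adj G u x * n ^ x)"], goal_cases bound written init step final)
      case bound
      then show ?case using step s by simp
    next
      case written
      then show ?case by simp
    next
      case init
      then show ?case by simp
    next
      case (step v s2 h2)
      have [simp]: "s2 ''n'' = of_nat n" "s2 ''u'' = of_nat u" "h2 = ?fill u"
        using step(4,5) \<open>s1 ''u'' = of_nat u\<close> \<open>h1 = ?fill u\<close> s
          \<open>\<And>z. z \<notin> insert ''u'' _ \<Longrightarrow> s1 z = s z\<close> by simp_all
      have i: "u * n + v < n * n" using \<open>u < n\<close> \<open>v < n\<close> by (rule matrix_index_less)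
      then have "?fill u (u * n + v) = of_nat (adj G u v)"
        using h[OF \<open>u < n\<close> \<open>v < n\<close>] by (simp add: fill_below)
      then show ?case
        using step i m by (simp add: wp_straight wp_Load[where i = "u * n + v"])
    next
      case (final k s2 h2)
      have [simp]: "s2 ''q'' = of_nat (n * n)" "s2 ''u'' = of_nat u" "h2 = ?fill u"
        using final(4,5) \<open>s1 ''u'' = of_nat u\<close> \<open>h1 = ?fill u\<close> s
          \<open>\<And>z. z \<notin> insert ''u'' _ \<Longrightarrow> s1 z = s z\<close> by simp_all
      have "2 * (n * n) + u < m" using \<open>u < n\<close> nn m by linarith
      then show ?case
        using final
        by (simp add: wp_Store[where i = "2 * (n * n) + u"] fill_Suc[symmetric] packed_row_def)
    qed
  next
    case (final k s1 h1)
    then show ?case by (simp add: algebra_simps)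
  qed (use s in simp_all)
qed

text \<open>The position \<open>i\<close> of a balanced ternary digit becomes the factor with exponent \<open>3 ^ i\<close>; cubing leads
  from one position to the next.\<close>

definition digit_powers :: prog where
  "digit_powers =
     Assign ''c'' (Add (Var ''f'') (Const 1)) ;;
     For ''i'' ''q''
       (Store (block 3 (Var ''i'')) (Var ''c'') ;;
        Assign ''c'' (Mul (Mul (Var ''c'') (Var ''c'')) (Var ''c'')))"

lemma wp_digit_powers:
  assumes s: "s ''q'' = of_nat q" "s ''f'' = fact n" and m: "4 * q \<le> m"
  shows "wp m digit_powers (s, h) (\<lambda>k (s', h'). k \<le> 100 * q + 100 \<and>
    h' = fill h (3 * q) q (\<lambda>i. of_nat (fact n + 1) ^ (3 ^ i)))"
proof -
  define X :: rat where "X = of_nat (fact n + 1)"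
  have X1: "fact n + 1 = X" by (simp add: X_def)
  have cube: "X ^ 3 ^ i * X ^ 3 ^ i * X ^ 3 ^ i = X ^ 3 ^ Suc i" for i
  proof -
    have "(3 :: nat) ^ Suc i = 3 ^ i + 3 ^ i + 3 ^ i" by simp
    then show ?thesis by (simp only: power_add)
  qed
  show ?thesis
    unfolding digit_powers_def wp_straight X_def[symmetric]
  proof (rule wp_For[where N = q and K = 50 and I = "\<lambda>i s' h'. s' ''c'' = X ^ (3 ^ i) \<and>
        h' = fill h (3 * q) i (\<lambda>i. X ^ (3 ^ i))"],
      goal_cases bound written init step final)
    case (step i s1 h1)
    then have [simp]: "s1 ''q'' = of_nat q" using s by simp
    have "3 * q + i < m" using step m by linarith
    then show ?case using step cube
      by (simp add: wp_straight wp_Store[where i = "3 * q + i"] fill_Suc[symmetric] del: power_Suc)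
  qed (use s X1 in simp_all)
qed

definition weight_code :: "nat \<Rightarrow> nat graph \<Rightarrow> nat \<Rightarrow> nat \<Rightarrow> rat" where
  "weight_code n G u v = of_nat (fact n + 1) powi commutator_weight n G u v"

text \<open>The factors \<open>1 + a(c - 1)\<close> and \<open>1 + b(d - 1)\<close> are \<open>c\<close> and \<open>d\<close> or \<open>1\<close>, depending on the entries \<open>a\<close> and \<open>b\<close> of
  the adjacency matrix. The single counter \<open>i\<close> runs through the pairs \<open>(u, v)\<close>.\<close>

definition weight_codes :: prog where
  "weight_codes =
     For ''i'' ''q''
       (Assign ''u'' (Floor (Div (Var ''i'') (Var ''n''))) ;;
        Assign ''v'' (Sub (Var ''i'') (Mul (Var ''u'') (Var ''n''))) ;;
        Assign ''e'' (Const 1) ;;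
        For ''j'' ''n''
          (Load ''a'' (Add (Mul (Var ''v'') (Var ''n'')) (Var ''j'')) ;;
           Load ''c'' (block 3 (Add (Mul (Var ''u'') (Var ''n'')) (Var ''j''))) ;;
           Load ''b'' (Add (Mul (Var ''j'') (Var ''n'')) (Var ''u'')) ;;
           Load ''d'' (block 3 (Add (Mul (Var ''j'') (Var ''n'')) (Var ''v''))) ;;
           Assign ''e'' (Div
             (Mul (Var ''e'') (Add (Const 1) (Mul (Var ''a'') (Sub (Var ''c'') (Const 1)))))
             (Add (Const 1) (Mul (Var ''b'') (Sub (Var ''d'') (Const 1)))))) ;;
        Store (block 4 (Var ''i'')) (Var ''e''))"

text \<open>After \<open>j\<close> rounds of the inner loop, \<open>e\<close> is \<open>x\<close> to the power of the first \<open>j\<close> terms of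
  \<open>commutator_weight n G u v\<close>.\<close>

lemma wp_weight_codes:
  assumes s: "s ''n'' = of_nat n" "s ''q'' = of_nat (n * n)" and m: "5 * (n * n) \<le> m"
    and h: "\<And>u v. u < n \<Longrightarrow> v < n \<Longrightarrow> h (u * n + v) = of_nat (adj G u v)"
    and h3: "\<And>i. i < n * n \<Longrightarrow> h (3 * (n * n) + i) = of_nat (fact n + 1) ^ (3 ^ i)"
  shows "wp m weight_codes (s, h) (\<lambda>k (s', h'). k \<le> n * n * (107 * n + 100) + 100 \<and>
    h' = fill h (4 * (n * n)) (n * n) (\<lambda>i. weight_code n G (i div n) (i mod n)))"
proof -
  let ?q = "n * n"
  let ?fill = "\<lambda>i. fill h (4 * ?q) i (\<lambda>i. weight_code n G (i div n) (i mod n))"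
  define X :: rat where "X = of_nat (fact n + 1)"
  have "fact n + 1 \<noteq> (0 :: nat)" by linarith
  then have X: "X \<noteq> 0" unfolding X_def by (simp only: of_nat_eq_0_iff not_False_eq_True)
  show ?thesis
    unfolding weight_codes_def
  proof (rule wp_For[where N = ?q and K = "107 * n + 80" and I = "\<lambda>i s' h'. h' = ?fill i"],
      goal_cases bound written init step final)
    case (step i s1 h1)
    define u v where "u = i div n" and "v = i mod n"
    have n: "n > 0" using \<open>i < ?q\<close> by (cases n) auto
    have u: "u < n" using \<open>i < ?q\<close> unfolding u_def by (simp add: less_mult_imp_div_less)
    have v: "v < n" unfolding v_def using n by simp
    have i_eq: "of_nat i = (of_nat u * of_nat n + of_nat v :: rat)"
      unfolding u_def v_def by (metis div_mult_mod_eq of_nat_add of_nat_mult)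
    have fl: "\<lfloor>of_nat i / of_nat n :: rat\<rfloor> = int u"
      unfolding u_def by (simp add: floor_divide_of_nat_eq)
    have [simp]: "s1 ''n'' = of_nat n" "s1 ''i'' = of_nat i" "s1 ''q'' = of_nat ?q" "h1 = ?fill i"
      using step s by simp_all
    let ?e = "\<lambda>j. \<Sum>x<j. int (adj G v x) * 3 ^ (u * n + x) - int (adj G x u) * 3 ^ (x * n + v)"
    show ?case
      unfolding wp_Seq wp_Assign
    proof (rule wp_For[where N = n and K = 100 and I = "\<lambda>j s' h'. s' ''e'' = X powi ?e j"],
        goal_cases bound written init step final)
      case (step j s2 h2)
      have [simp]: "s2 ''n'' = of_nat n" "s2 ''u'' = of_nat u" "s2 ''v'' = of_nat v"
          "s2 ''q'' = of_nat ?q" "h2 = ?fill i"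
        using step(4,5) fl i_eq by simp_all
      have i1: "v * n + j < ?q" "j * n + u < ?q" "u * n + j < ?q" "j * n + v < ?q"
        using u v \<open>j < n\<close> by (auto intro: matrix_index_less)
      have mem: "?fill i (v * n + j) = of_nat (adj G v j)" "?fill i (j * n + u) = of_nat (adj G j u)"
        "?fill i (3 * ?q + (u * n + j)) = X ^ (3 ^ (u * n + j))"
        "?fill i (3 * ?q + (j * n + v)) = X ^ (3 ^ (j * n + v))"
        using i1 h[OF v \<open>j < n\<close>] h[OF \<open>j < n\<close> u] h3[of "u * n + j"] h3[of "j * n + v"]
        by (simp_all add: fill_below X_def)
      have "X powi ?e j * (1 + of_nat (adj G v j) * (X ^ (3 ^ (u * n + j)) - 1)) /
            (1 + of_nat (adj G j u) * (X ^ (3 ^ (j * n + v)) - 1)) = X powi ?e (Suc j)"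
      proof -
        have *: "1 + of_nat (adj G x y) * (X ^ t - 1) = X powi (int (adj G x y) * int t)" for x y t
          by (simp add: adj_def)
        show ?thesis unfolding * sum.lessThan_Suc
          using X by (simp add: power_int_add power_int_diff)
      qed
      then show ?case
        using step(3) \<open>s2 ''e'' = _\<close> i1 m mem
        by (simp add: wp_straight wp_Load[where i = "v * n + j"] wp_Load[where i = "j * n + u"]
          wp_Load[where i = "3 * ?q + (u * n + j)"] wp_Load[where i = "3 * ?q + (j * n + v)"] del: sum.lessThan_Suc)
    next
      case (final k s2 h2)
      have [simp]: "s2 ''q'' = of_nat ?q" "s2 ''i'' = of_nat i" "h2 = ?fill i"
        using final(4,5) by simp_all
      have "4 * ?q + i < m" using \<open>i < ?q\<close> m by linarith
      then show ?case
        using final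
        by (simp add: wp_Store[where i = "4 * ?q + i"] fill_Suc[symmetric] weight_code_def
            commutator_weight_def X_def u_def v_def)
    qed simp_all
  next
    case (final k s1 h1)
    then show ?case by (simp add: algebra_simps)
  qed (use s in simp_all)
qed

section \<open>Subsets, degrees and the recursion over rationals\<close>

lemma digit_of_base_sum:
  fixes d :: "nat \<Rightarrow> nat"
  assumes "\<And>i. i < N \<Longrightarrow> d i < n" "v < N"
  shows "(\<Sum>i<N. d i * n ^ i) div n ^ v mod n = d v"
  using assms
proof (induction v arbitrary: d N)
  case (0 d N)
  then obtain M where "N = Suc M" by (cases N) auto
  then have "(\<Sum>i<N. d i * n ^ i) = d 0 + n * (\<Sum>i<M. d (Suc i) * n ^ i)"
    by (simp only: sum.lessThan_Suc_shift) (simp add: sum_distrib_left mult_ac)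
  then show ?case using 0 by simp
next
  case (Suc v d N)
  then obtain M where N: "N = Suc M" by (cases N) auto
  have "(\<Sum>i<N. d i * n ^ i) = d 0 + n * (\<Sum>i<M. d (Suc i) * n ^ i)"
    unfolding N by (simp only: sum.lessThan_Suc_shift) (simp add: sum_distrib_left mult_ac)
  moreover have "d 0 < n" using Suc.prems N by simp
  ultimately have "(\<Sum>i<N. d i * n ^ i) div n = (\<Sum>i<M. d (Suc i) * n ^ i)" by simp
  then have "(\<Sum>i<N. d i * n ^ i) div n ^ Suc v = (\<Sum>i<M. d (Suc i) * n ^ i) div n ^ v"
    by (simp add: div_mult2_eq)
  moreover have "(\<Sum>i<M. d (Suc i) * n ^ i) div n ^ v mod n = d (Suc v)"
    using Suc.prems N by (intro Suc.IH[of M "\<lambda>i. d (Suc i)"]) auto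
  ultimately show ?case by simp
qed

lemma set_decode_below:
  assumes "x < 2 ^ n" shows "set_decode x \<subseteq> {..<n}"
proof
  fix v assume "v \<in> set_decode x"
  then have "x div 2 ^ v \<noteq> 0" by (auto simp: set_decode_def intro: ccontr)
  then have "2 ^ v \<le> x" by (meson div_less not_le)
  then have "(2 :: nat) ^ v < 2 ^ n" using assms by linarith
  then show "v \<in> {..<n}" by simp
qed

text \<open>Removal of an element lowers the binary code, so the table entry for \<open>S - {v}\<close> is available when
  that for \<open>S\<close> is computed.\<close>

lemma set_decode_remove:
  assumes "v \<in> set_decode x"
  obtains y where "x = y + 2 ^ v" "set_decode y = set_decode x - {v}"
proof -
  have "x = set_encode (insert v (set_decode x - {v}))"
    using assms by (simp add: insert_absorb)
  also have "\<dots> = 2 ^ v + set_encode (set_decode x - {v})"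
    by (rule set_encode_insert) auto
  finally show ?thesis using that[of "set_encode (set_decode x - {v})"] by simp
qed

lemma set_decode_full: "set_decode (2 ^ n - 1) = {..<n}"
proof -
  have "set_encode {..<n} = 2 ^ n - 1"
    using sum_power2[of n] by (simp add: set_encode_def atLeast0LessThan)
  then show ?thesis by (metis finite_lessThan set_encode_inverse)
qed

lemma Int_lessThan_Suc: "A \<inter> {..<Suc v} = (if v \<in> A then insert v (A \<inter> {..<v}) else A \<inter> {..<v})"
  by (auto simp: less_Suc_eq)

lemma of_nat_minus_div: "(of_nat y :: rat) - of_nat n * of_nat (y div n) = of_nat (y mod n)"
proof -
  have "y = n * (y div n) + y mod n" by simp
  then have "(of_nat y :: rat) = of_nat n * of_nat (y div n) + of_nat (y mod n)"
    by (metis of_nat_add of_nat_mult)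
  then show ?thesis by simp
qed

lemma floor_of_nat_div: "of_int \<lfloor>(of_nat y :: rat) / of_nat n\<rfloor> = (of_nat (y div n) :: rat)"
  by (simp add: floor_divide_of_nat_eq)

definition degree_within :: "nat graph \<Rightarrow> nat set \<Rightarrow> nat \<Rightarrow> nat" where
  "degree_within G S v = (\<Sum>u\<in>S. adj G u v)"

lemma degree_induced_subgraph_eq:
  assumes "finite S" "v \<in> S"
  shows "degree (induced_subgraph G S) v = degree_within G S v"
proof -
  have "{u \<in> verts (induced_subgraph G S). {u, v} \<in> edges (induced_subgraph G S)} = {u \<in> S. {u, v} \<in> edges G}"
    using assms(2) by (auto simp: induced_subgraph_def)
  moreover have "(\<Sum>u\<in>S. adj G u v) = card {u \<in> S. {u, v} \<in> edges G}"
    using assms(1) by (simp add: adj_def sum.If_cases Int_def)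
  ultimately show ?thesis by (simp add: degree_def degree_within_def)
qed

text \<open>A vertex is not its own neighbour. For subsets of \<open>{..<n}\<close> this keeps the degree below the base \<open>n\<close>,
  and for \<open>v \<in> S\<close> it makes the binomial coefficient in the recursion nonzero.\<close>

lemma degree_within_le:
  assumes "simple_graph G" "finite S"
  shows "degree_within G S v \<le> card (S - {v})"
proof -
  have "degree_within G S v = (\<Sum>u\<in>S - {v}. adj G u v)"
    unfolding degree_within_def using assms simple_graph_no_loop[OF assms(1), of v]
    by (intro sum.mono_neutral_right) (auto simp: adj_def)
  also have "\<dots> \<le> of_nat (card (S - {v})) * 1"
    by (intro sum_bounded_above) (simp add: adj_def)
  finally show ?thesis by simp
qed

text \<open>Addition of packed rows adds the digits separately, as no digit reaches \<open>n\<close> and so there are no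
  carries.\<close>

lemma packed_degree_within:
  assumes G: "simple_graph G" and S: "S \<subseteq> {..<n}" and v: "v < n"
  shows "(\<Sum>u\<in>S. packed_row n G u) div n ^ v mod n = degree_within G S v"
proof -
  have fin: "finite S" using S finite_subset by blast
  have "(\<Sum>u\<in>S. packed_row n G u) = (\<Sum>v<n. degree_within G S v * n ^ v)"
    unfolding packed_row_def degree_within_def sum_distrib_right by (rule sum.swap)
  moreover have "degree_within G S i < n" if "i < n" for i
  proof -
    have "card (S - {i}) \<le> card ({..<n} - {i})" using S by (intro card_mono) auto
    then show ?thesis using degree_within_le[OF G fin, of i] that by simp
  qed
  ultimately show ?thesis using v by (simp add: digit_of_base_sum)
qed

text \<open>The machine works with rationals while \<open>F\<close> is real valued; its values are rational because the
  recursion only adds and divides.\<close>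

definition F_rat :: "nat graph \<Rightarrow> nat set \<Rightarrow> rat" where
  "F_rat G S = (SOME r. of_rat r = F G S)"

lemma of_rat_F_rat:
  assumes "simple_graph G" "finite S"
  shows "of_rat (F_rat G S) = F G S"
proof -
  have "F G S \<in> \<rat>" using assms(2)
  proof (induction "card S" arbitrary: S)
    case 0
    then show ?case by (simp add: F.simps)
  next
    case (Suc t)
    then have "S \<noteq> {}" by auto
    have "F G (S - {v}) \<in> \<rat>" if "v \<in> S" for v
      using Suc that by (intro Suc.hyps(1)) auto
    then show ?case
      unfolding F_rec_nonempty[OF assms(1) Suc.prems \<open>S \<noteq> {}\<close>]
      by (intro Rats_sum Rats_divide) auto
  qed
  then have "\<exists>r. of_rat r = F G S" by (auto elim: Rats_cases)
  then show ?thesis unfolding F_rat_def by (rule someI_ex)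
qed

lemma F_rat_empty: "F_rat G {} = 1"
proof -
  have "\<exists>r. of_rat r = F G {}" by (rule exI[of _ 1]) (simp add: F.simps)
  then have "of_rat (F_rat G {}) = F G {}" unfolding F_rat_def by (rule someI_ex)
  then show ?thesis by (simp add: F.simps)
qed

text \<open>With the binomial coefficient written in factorials, a table of \<open>n\<close> factorials suffices.\<close>

lemma F_rat_rec:
  assumes G: "simple_graph G" and S: "finite S" "S \<noteq> {}"
  shows "F_rat G S = (\<Sum>v\<in>S. F_rat G (S - {v}) * fact (degree_within G S v) *
    fact (card S - 1 - degree_within G S v) / fact (card S - 1))"
proof -
  have "(of_rat (F_rat G S) :: real) = of_rat (\<Sum>v\<in>S. F_rat G (S - {v}) * fact (degree_within G S v) *
    fact (card S - 1 - degree_within G S v) / fact (card S - 1))"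
    unfolding of_rat_F_rat[OF G S(1)] F_rec_nonempty[OF G S] of_rat_sum
  proof (rule sum.cong[OF refl])
    fix v assume v: "v \<in> S"
    let ?d = "degree_within G S v"
    have of_rat_fact: "(of_rat (fact k) :: real) = fact k" for k
      by (metis of_nat_fact of_rat_of_nat_eq)
    have "?d \<le> card S - 1" using degree_within_le[OF G S(1), of v] v S by simp
    then have choose: "real ((card S - 1) choose ?d) = fact (card S - 1) / (fact ?d * fact (card S - 1 - ?d))"
      by (rule binomial_fact)
    then show "F G (S - {v}) / real ((card S - 1) choose degree (induced_subgraph G S) v) =
      of_rat (F_rat G (S - {v}) * fact ?d * fact (card S - 1 - ?d) / fact (card S - 1))"
      unfolding degree_induced_subgraph_eq[OF S(1) v] choose of_rat_mult of_rat_divide of_rat_fact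
      using of_rat_F_rat[OF G, of "S - {v}"] S(1) by simp
  qed
  then show ?thesis by simp
qed

section \<open>The tables over subsets\<close>

text \<open>Adds the contribution of the vertex \<open>v\<close>, whose bit is \<open>w = 2 ^ v\<close>, to both recursions: \<open>x\<close> is the code
  of the subset, \<open>k\<close> its size and \<open>d\<close> the degree of \<open>v\<close> in it.\<close>

definition accumulate :: prog where
  "accumulate =
     Load ''a'' (block 5 (Sub (Var ''x'') (Var ''w''))) ;;
     Load ''b'' (block 1 (Var ''d'')) ;;
     Assign ''a'' (Mul (Var ''a'') (Var ''b'')) ;;
     Load ''b'' (block 1 (Sub (Sub (Var ''k'') (Const 1)) (Var ''d''))) ;;
     Assign ''a'' (Mul (Var ''a'') (Var ''b'')) ;;
     Load ''b'' (block 1 (Sub (Var ''k'') (Const 1))) ;;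
     Assign ''y'' (Add (Var ''y'') (Div (Var ''a'') (Var ''b''))) ;;
     Load ''a'' (block 5 (Add (Var ''N'') (Sub (Var ''x'') (Var ''w'')))) ;;
     Load ''b'' (block 4 (Add (Mul (Sub (Var ''k'') (Const 1)) (Var ''n'')) (Var ''v''))) ;;
     Assign ''z'' (Add (Var ''z'') (Mul (Var ''a'') (Var ''b'')))"

text \<open>The truncated differences are avoided by writing the code as \<open>y + w\<close> and the size as \<open>d + e + 1\<close>.\<close>

lemma wp_accumulate:
  assumes s: "s ''q'' = of_nat q" "s ''n'' = of_nat n" "s ''N'' = of_nat N" "s ''w'' = of_nat w"
      "s ''x'' = of_nat (y + w)" "s ''d'' = of_nat d" "s ''k'' = of_nat (d + e + 1)" "s ''v'' = of_nat v"
    and bounds: "d + e < q" "(d + e) * n + v < q" "y < N" "5 * q + 2 * N \<le> m"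
  shows "wp m accumulate (s, h) (\<lambda>l (s', h'). l \<le> 100 \<and>
    s' ''y'' = s ''y'' + h (5 * q + y) * h (q + d) * h (q + e) / h (q + (d + e)) \<and>
    s' ''z'' = s ''z'' + h (5 * q + (N + y)) * h (4 * q + ((d + e) * n + v)))"
proof -
  have "5 * q + y < m" "q + d < m" "q + e < m" "q + (d + e) < m" "5 * q + (N + y) < m"
    "4 * q + ((d + e) * n + v) < m"
    using bounds by linarith+
  then show ?thesis
    unfolding accumulate_def using s
    by (simp add: wp_straight wp_Load[where i = "5 * q + y"] wp_Load[where i = "q + d"]
        wp_Load[where i = "q + e"] wp_Load[where i = "q + (d + e)"]
        wp_Load[where i = "5 * q + (N + y)"] wp_Load[where i = "4 * q + ((d + e) * n + v)"])
qed

lemma fill_fill_Suc: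
  assumes "i < N"
  shows "(fill (fill h b i f) (b + N) i g)(b + i := f i, b + (N + i) := g i) =
    fill (fill h b (Suc i) f) (b + N) (Suc i) g"
  using assms by (auto simp: fill_def fun_eq_iff)

lemma div_power_Suc: "x div 2 ^ v div 2 = (x :: nat) div 2 ^ Suc v"
  by (simp add: div_mult2_eq[symmetric] mult.commute)

lemma bit_eq: "(of_nat (x div 2 ^ v) :: rat) - 2 * of_nat (x div 2 ^ Suc v) = (if v \<in> set_decode x then 1 else 0)"
proof -
  have "(of_nat (x div 2 ^ v) :: rat) - of_nat 2 * of_nat (x div 2 ^ v div 2) = of_nat (x div 2 ^ v mod 2)"
    by (rule of_nat_minus_div)
  moreover have "x div 2 ^ v mod 2 = (if v \<in> set_decode x then 1 else 0)"
    by (auto simp: set_decode_def odd_iff_mod_2_eq_one)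
  ultimately show ?thesis unfolding div_power_Suc by (auto split: if_splits)
qed

lemma halve_eq: "of_int \<lfloor>(of_nat (x div 2 ^ v) :: rat) / 2\<rfloor> = (of_nat (x div 2 ^ Suc v) :: rat)"
  using floor_of_nat_div[of "x div 2 ^ v" 2] unfolding div_power_Suc by simp

definition next_bit :: prog where
  "next_bit =
     Assign ''g'' (Floor (Div (Var ''t'') (Const 2))) ;;
     Assign ''b'' (Sub (Var ''t'') (Mul (Const 2) (Var ''g''))) ;;
     Assign ''t'' (Var ''g'')"

text \<open>A first pass over the bits of the code \<open>x\<close> determines the size of the subset and the number whose
  digits are the degrees. Recomputing them costs \<open>O(n)\<close> per subset, no more than the recursion itself,
  and saves two tables.\<close>

definition scan_subset :: prog where
  "scan_subset =
     Assign ''t'' (Var ''x'') ;; Assign ''k'' (Const 0) ;; Assign ''r'' (Const 0) ;;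
     For ''v'' ''n''
       (next_bit ;;
        Assign ''k'' (Add (Var ''k'') (Var ''b'')) ;;
        Load ''a'' (block 2 (Var ''v'')) ;;
        Assign ''r'' (Add (Var ''r'') (Mul (Var ''b'') (Var ''a''))))"

lemma wp_scan_subset:
  assumes s: "s ''n'' = of_nat n" "s ''q'' = of_nat q" "s ''x'' = of_nat x" and x: "x < 2 ^ n"
    and m: "2 * q + n \<le> m"
    and h2: "\<And>u. u < n \<Longrightarrow> h (2 * q + u) = of_nat (packed_row n G u)"
  shows "wp m scan_subset (s, h) (\<lambda>k (s', h'). k \<le> 57 * n + 50 \<and>
    s' ''k'' = of_nat (card (set_decode x)) \<and>
    s' ''r'' = of_nat (\<Sum>u\<in>set_decode x. packed_row n G u))"
  unfolding scan_subset_def wp_Seq wp_Assign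
proof (rule wp_For[where N = n and K = 50 and I = "\<lambda>v s' h'. s' ''t'' = of_nat (x div 2 ^ v) \<and>
      s' ''k'' = of_nat (card (set_decode x \<inter> {..<v})) \<and>
      s' ''r'' = of_nat (\<Sum>u\<in>set_decode x \<inter> {..<v}. packed_row n G u)"], goal_cases bound written init step final)
  case (step v s2 h2)
  have [simp]: "s2 ''n'' = of_nat n" "s2 ''q'' = of_nat q" "h2 = h"
    using step(4,5) s by (simp_all add: next_bit_def)
  have "2 * q + v < m" using m \<open>v < n\<close> by simp
  then show ?case
    using step(2,3) assms(6)[OF \<open>v < n\<close>]
    by (simp add: next_bit_def wp_straight wp_Load[where i = "2 * q + v"] halve_eq bit_eq Int_lessThan_Suc
      del: power_Suc)
next
  case (final k1 s2 h2)
  have "set_decode x \<inter> {..<n} = set_decode x" using set_decode_below[OF x] by auto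
  then show ?case using final(1,2) by simp
qed (use s in \<open>simp_all add: next_bit_def\<close>)

text \<open>The second pass reads bit \<open>v\<close> of the code and digit \<open>v\<close> of the packed degrees in lockstep.\<close>

definition sum_over_subset :: prog where
  "sum_over_subset =
     Assign ''t'' (Var ''x'') ;; Assign ''w'' (Const 1) ;;
     For ''v'' ''n''
       (next_bit ;;
        Assign ''g'' (Floor (Div (Var ''r'') (Var ''n''))) ;;
        Assign ''d'' (Sub (Var ''r'') (Mul (Var ''n'') (Var ''g''))) ;;
        Assign ''r'' (Var ''g'') ;;
        IfLess (Const 0) (Var ''b'') accumulate Skip ;;
        Assign ''w'' (Add (Var ''w'') (Var ''w'')))"

lemma written_accumulate [simp]: "written accumulate = {''a'', ''b'', ''y'', ''z''}"
  by (auto simp: accumulate_def)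

lemma stores_accumulate [simp]: "\<not> stores accumulate"
  by (simp add: accumulate_def)

lemma written_next_bit [simp]: "written next_bit = {''g'', ''b'', ''t''}"
  by (auto simp: next_bit_def)

lemma stores_next_bit [simp]: "\<not> stores next_bit"
  by (simp add: next_bit_def)

text \<open>After \<open>v\<close> rounds, \<open>y\<close> and \<open>z\<close> hold the parts of the two recursions that belong to the elements below
  \<open>v\<close>. The initial value accounts for the empty subset, where both recursions have the value \<open>1\<close>.\<close>

lemma wp_sum_over_subset:
  assumes s: "s ''n'' = of_nat n" "s ''q'' = of_nat (n * n)" "s ''N'' = of_nat N" "s ''x'' = of_nat x"
      "s ''k'' = of_nat (card (set_decode x))"
      "s ''r'' = of_nat (\<Sum>u\<in>set_decode x. packed_row n G u)"
      "s ''y'' = (if x = 0 then 1 else 0)" "s ''z'' = (if x = 0 then 1 else 0)"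
    and x: "x < 2 ^ n" "x < N"
    and m: "5 * (n * n) + 2 * N \<le> m"
    and G: "simple_graph G"
    and h1: "\<And>i. i < n \<Longrightarrow> h (n * n + i) = fact i"
    and h4: "\<And>u v. u < n \<Longrightarrow> v < n \<Longrightarrow> h (4 * (n * n) + (u * n + v)) = weight_code n G u v"
    and hF: "\<And>y. y < x \<Longrightarrow> h (5 * (n * n) + y) = F_rat G (set_decode y)"
    and hP: "\<And>y. y < x \<Longrightarrow> h (5 * (n * n) + (N + y)) = perm_sum (weight_code n G) (set_decode y)"
  shows "wp m sum_over_subset (s, h) (\<lambda>k (s', h'). k \<le> 207 * n + 50 \<and>
    s' ''y'' = F_rat G (set_decode x) \<and> s' ''z'' = perm_sum (weight_code n G) (set_decode x))"
proof -
  define q where "q = n * n"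
  let ?S = "set_decode x"
  define y0 :: rat where "y0 = (if x = 0 then 1 else 0)"
  let ?R = "\<Sum>u\<in>?S. packed_row n G u"
  define f where "f v = F_rat G (?S - {v}) * fact (degree_within G ?S v) *
      fact (card ?S - 1 - degree_within G ?S v) / fact (card ?S - 1)" for v
  define g where "g v = perm_sum (weight_code n G) (?S - {v}) * weight_code n G (card ?S - 1) v" for v
  have S: "?S \<subseteq> {..<n}" using x(1) by (rule set_decode_below)
  show ?thesis
    unfolding sum_over_subset_def wp_Seq wp_Assign
  proof (rule wp_For[where N = n and K = 200 and I = "\<lambda>v s' h'. s' ''t'' = of_nat (x div 2 ^ v) \<and>
            s' ''w'' = of_nat (2 ^ v) \<and> s' ''r'' = of_nat (?R div n ^ v) \<and>
            s' ''y'' = y0 + (\<Sum>u\<in>?S \<inter> {..<v}. f u) \<and> s' ''z'' = y0 + (\<Sum>u\<in>?S \<inter> {..<v}. g u)"],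
          goal_cases bound written init step final)
    case (step v s2 h2)
    have [simp]: "s2 ''n'' = of_nat n" "s2 ''q'' = of_nat q" "s2 ''N'' = of_nat N" "s2 ''x'' = of_nat x"
        "s2 ''k'' = of_nat (card ?S)" "s2 ''v'' = of_nat v" "h2 = h"
      using step(3,4,5) s by (simp_all add: q_def)
    \<comment> \<open>The digit and the shifted number that the program computes from \<open>r\<close>.\<close>
    have digit: "of_nat (?R div n ^ v) - of_nat n * of_nat (?R div n ^ Suc v) = (of_nat (degree_within G ?S v) :: rat)"
      using of_nat_minus_div[of "?R div n ^ v" n] packed_degree_within[OF G S \<open>v < n\<close>]
      by (simp add: div_mult2_eq[symmetric] mult.commute)
    have shift: "of_int \<lfloor>(of_nat (?R div n ^ v) :: rat) / of_nat n\<rfloor> = (of_nat (?R div n ^ Suc v) :: rat)"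
      using floor_of_nat_div[of "?R div n ^ v" n] by (simp add: div_mult2_eq[symmetric] mult.commute)
    note I = step(2)
    show ?case
    proof (cases "v \<in> ?S")
      case False
      then show ?thesis
        using I
        by (simp add: next_bit_def wp_straight halve_eq bit_eq shift Int_lessThan_Suc del: power_Suc)
          (simp add: power_Suc)
    next
      case True
      \<comment> \<open>Here \<open>y\<close> is the code of the subset without \<open>v\<close>.\<close>
      obtain y where y: "x = y + 2 ^ v" "set_decode y = ?S - {v}"
        using set_decode_remove[OF True] .
      have "y < x" using y(1) by simp
      let ?d = "degree_within G ?S v"
      have "card ?S > 0" using True by (auto simp: card_gt_0_iff)
      moreover have "?d \<le> card ?S - 1" using degree_within_le[OF G, of ?S v] True by simp
      ultimately obtain e where e: "card ?S = ?d + e + 1"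
        by (metis add.commute add_Suc_right le_Suc_ex Suc_pred' plus_1_eq_Suc)
      have "card ?S \<le> n" using card_mono[OF _ S] by simp
      then have small: "?d + e < n" "?d < n" "e < n" using e by linarith+
      have "n \<le> q" by (simp add: q_def)
      have mem: "h (5 * q + y) = F_rat G (?S - {v})" "h (q + ?d) = fact ?d" "h (q + e) = fact e"
        "h (q + (?d + e)) = fact (?d + e)" "h (5 * q + (N + y)) = perm_sum (weight_code n G) (?S - {v})"
        "h (4 * q + ((?d + e) * n + v)) = weight_code n G (?d + e) v"
        using hF[OF \<open>y < x\<close>] hP[OF \<open>y < x\<close>] y(2) h1 h4[OF small(1) \<open>v < n\<close>] small
        by (simp_all add: q_def)
      have acc: "wp m accumulate (s3, h) (\<lambda>l (s', h'). l \<le> 100 \<and>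
          s' ''y'' = s3 ''y'' + f v \<and> s' ''z'' = s3 ''z'' + g v \<and> h' = h \<and>
          (\<forall>z. z \<notin> {''a'', ''b'', ''y'', ''z''} \<longrightarrow> s' z = s3 z))"
        if s3: "s3 ''q'' = of_nat q" "s3 ''n'' = of_nat n" "s3 ''N'' = of_nat N" "s3 ''w'' = of_nat (2 ^ v)"
          "s3 ''x'' = of_nat (y + 2 ^ v)" "s3 ''d'' = of_nat ?d" "s3 ''k'' = of_nat (?d + e + 1)"
          "s3 ''v'' = of_nat v" for s3
      proof (rule wp_frame[OF wp_accumulate[OF s3]])
        show "?d + e < q" using small(1) \<open>n \<le> q\<close> by simp
        show "(?d + e) * n + v < q" unfolding q_def by (rule matrix_index_less[OF small(1) \<open>v < n\<close>])
        show "y < N" using \<open>y < x\<close> x(2) by simp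
        show "5 * q + 2 * N \<le> m" using m by (simp add: q_def)
      qed (simp_all add: mem e f_def g_def)
      have I': "s2 ''t'' = of_nat (x div 2 ^ v)" "s2 ''w'' = of_nat (2 ^ v)" "s2 ''r'' = of_nat (?R div n ^ v)"
        "s2 ''y'' = y0 + sum f (?S \<inter> {..<v})" "s2 ''z'' = y0 + sum g (?S \<inter> {..<v})"
        using I by simp_all
      have xe: "of_nat x = (of_nat y + 2 ^ v :: rat)" using y(1) by simp
      have ke: "of_nat (card ?S) = (of_nat ?d + of_nat e + 1 :: rat)" using e by simp
      have sums: "sum f (?S \<inter> {..<Suc v}) = sum f (?S \<inter> {..<v}) + f v"
        "sum g (?S \<inter> {..<Suc v}) = sum g (?S \<inter> {..<v}) + g v"
        using True by (simp_all add: Int_lessThan_Suc)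
      show ?thesis
        apply (simp add: next_bit_def wp_straight halve_eq bit_eq shift digit True I'(1,3) del: power_Suc)
        apply (rule wp_mono[OF acc])
        apply (simp_all add: I'(2) xe ke)[8]
        subgoal for l \<sigma>'
          apply (cases \<sigma>')
          apply (simp only: prod.case)
          apply (elim conjE)
          apply (simp add: I' sums wp_straight)
          done
        done
    qed
  next
    case (final k s2 h2)
    have "?S \<inter> {..<n} = ?S" using S by auto
    have "y0 + sum f ?S = F_rat G ?S \<and> y0 + sum g ?S = perm_sum (weight_code n G) ?S"
    proof (cases "x = 0")
      case True
      then show ?thesis by (simp add: y0_def F_rat_empty perm_sum_empty)
    next
      case False
      then have "?S \<noteq> {}" by (metis set_decode_inverse set_encode_empty)
      then have "F_rat G ?S = sum f ?S" "perm_sum (weight_code n G) ?S = sum g ?S"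
        unfolding f_def g_def by (simp_all only: F_rat_rec[OF G finite_set_decode] perm_sum_rec[OF finite_set_decode] not_False_eq_True)
      then show ?thesis using False by (simp add: y0_def)
    qed
    then show ?case using final(1,2) \<open>?S \<inter> {..<n} = ?S\<close> by simp
  qed (use s in \<open>simp_all add: y0_def\<close>)
qed

definition subset_table :: prog where
  "subset_table =
     For ''x'' ''N''
       (scan_subset ;;
        IfLess (Const 0) (Var ''x'') (Assign ''y'' (Const 0)) (Assign ''y'' (Const 1)) ;;
        Assign ''z'' (Var ''y'') ;;
        sum_over_subset ;;
        Store (block 5 (Var ''x'')) (Var ''y'') ;;
        Store (block 5 (Add (Var ''N'') (Var ''x''))) (Var ''z''))"

lemma written_scan_subset [simp]: "written scan_subset = {''t'', ''k'', ''r'', ''v'', ''g'', ''b'', ''a''}"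
  by (auto simp: scan_subset_def)

lemma stores_scan_subset [simp]: "\<not> stores scan_subset"
  by (simp add: scan_subset_def)

lemma written_sum_over_subset [simp]:
  "written sum_over_subset = {''t'', ''w'', ''v'', ''g'', ''b'', ''d'', ''r'', ''a'', ''y'', ''z''}"
  by (auto simp: sum_over_subset_def)

lemma stores_sum_over_subset [simp]: "\<not> stores sum_over_subset"
  by (simp add: sum_over_subset_def)

text \<open>The invariant says that both tables are filled below \<open>x\<close>; by \<open>set_decode_remove\<close> the second pass
  reads only these entries and, below address \<open>5q\<close>, the unchanged tables of polynomial size.\<close>

lemma wp_subset_table:
  assumes s: "s ''n'' = of_nat n" "s ''q'' = of_nat (n * n)" "s ''N'' = of_nat (2 ^ n)"
    and m: "5 * (n * n) + 2 * 2 ^ n \<le> m"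
    and G: "simple_graph G"
    and h1: "\<And>i. i < n \<Longrightarrow> h (n * n + i) = fact i"
    and h2: "\<And>u. u < n \<Longrightarrow> h (2 * (n * n) + u) = of_nat (packed_row n G u)"
    and h4: "\<And>u v. u < n \<Longrightarrow> v < n \<Longrightarrow> h (4 * (n * n) + (u * n + v)) = weight_code n G u v"
  shows "wp m subset_table (s, h) (\<lambda>k (s', h'). k \<le> 2 ^ n * (264 * n + 200) + 100 \<and>
    h' = fill (fill h (5 * (n * n)) (2 ^ n) (\<lambda>x. F_rat G (set_decode x))) (5 * (n * n) + 2 ^ n) (2 ^ n)
      (\<lambda>x. perm_sum (weight_code n G) (set_decode x)))"
proof -
  define q where "q = n * n"
  define N :: nat where "N = 2 ^ n"
  let ?f = "\<lambda>x. F_rat G (set_decode x)" and ?g = "\<lambda>x. perm_sum (weight_code n G) (set_decode x)"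
  let ?fill = "\<lambda>i. fill (fill h (5 * q) i ?f) (5 * q + N) i ?g"
  show ?thesis
    unfolding subset_table_def q_def[symmetric] N_def[symmetric]
  proof (rule wp_For[where N = N and K = "264 * n + 193" and I = "\<lambda>i s' h'. h' = ?fill i"],
      goal_cases bound written init step final)
    case (step x s1 h1)
    have s1: "s1 ''n'' = of_nat n" "s1 ''q'' = of_nat q" "s1 ''N'' = of_nat N" "s1 ''x'' = of_nat x"
      "h1 = ?fill x"
      using step s by (simp_all add: q_def N_def)
    have bounds: "5 * q + 2 * N \<le> m" "n \<le> q" using m by (simp_all add: q_def N_def)
    have x: "x < 2 ^ n" "x < N" using \<open>x < N\<close> by (simp_all add: N_def)
    have below: "?fill x a = h a" if "a < 5 * q" for a
      using that by (simp add: fill_below)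
    have scan: "wp m scan_subset (s1, ?fill x) (\<lambda>k (s', h'). k \<le> 57 * n + 50 \<and>
        s' ''k'' = of_nat (card (set_decode x)) \<and>
        s' ''r'' = of_nat (\<Sum>u\<in>set_decode x. packed_row n G u))"
    proof (rule wp_scan_subset[OF s1(1,2,4) x(1)])
      show "2 * q + n \<le> m" using bounds by linarith
      show "?fill x (2 * q + u) = of_nat (packed_row n G u)" if "u < n" for u
      proof -
        have "2 * q + u < 5 * q" using that bounds by linarith
        then show ?thesis using below[of "2 * q + u"] h2[OF that] by (simp add: q_def)
      qed
    qed
    have sum: "wp m sum_over_subset (s2, ?fill x) (\<lambda>k (s', h'). k \<le> 207 * n + 50 \<and>
        s' ''y'' = ?f x \<and> s' ''z'' = ?g x)"
      if s2: "s2 ''n'' = of_nat n" "s2 ''q'' = of_nat q" "s2 ''N'' = of_nat N" "s2 ''x'' = of_nat x"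
        "s2 ''k'' = of_nat (card (set_decode x))"
        "s2 ''r'' = of_nat (\<Sum>u\<in>set_decode x. packed_row n G u)"
        "s2 ''y'' = (if x = 0 then 1 else 0)" "s2 ''z'' = (if x = 0 then 1 else 0)" for s2
    proof (rule wp_sum_over_subset[OF s2[unfolded q_def] x _ G], goal_cases m fact weight F P)
      case m
      then show ?case using bounds by (simp add: q_def)
    next
      case (fact i)
      have "q + i < 5 * q" using fact bounds by linarith
      then show ?case using below[of "q + i"] h1[OF fact] by (simp add: q_def)
    next
      case (weight u v)
      have "4 * q + (u * n + v) < 5 * q" using matrix_index_less[OF weight] by (simp add: q_def)
      then show ?case using below[of "4 * q + (u * n + v)"] h4[OF weight] by (simp add: q_def)
    next
      case (F y)
      then show ?case using x(2) by (simp add: q_def[symmetric] fill_below fill_inside)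
    next
      case (P y)
      then show ?case
        using fill_inside[of y x "fill h (5 * q) x ?f" "5 * q + N" ?g]
        by (simp add: q_def[symmetric] add.assoc)
    qed
    have addr: "5 * q + x < m" "5 * q + (N + x) < m" using x bounds by linarith+
    show ?case
      unfolding wp_Seq s1(5)
    proof (rule wp_frame[OF scan], goal_cases scan)
      case (scan k1 s2 h2)
      then have s2: "s2 ''n'' = of_nat n" "s2 ''q'' = of_nat q" "s2 ''N'' = of_nat N" "s2 ''x'' = of_nat x"
        "s2 ''k'' = of_nat (card (set_decode x))"
        "s2 ''r'' = of_nat (\<Sum>u\<in>set_decode x. packed_row n G u)" "h2 = ?fill x" "k1 \<le> 57 * n + 50"
        using s1 by simp_all
      have store: "wp m sum_over_subset (s3, ?fill x)
        (\<lambda>k \<sigma>'. wp m (Store (block 5 (Var ''x'')) (Var ''y'')) \<sigma>'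
          (\<lambda>l \<sigma>''. wp m (Store (block 5 (Add (Var ''N'') (Var ''x''))) (Var ''z'')) \<sigma>''
            (\<lambda>j (s', h'). k + (l + j) \<le> 207 * n + 100 \<and> h' = ?fill (Suc x) \<and> s' ''x'' = of_nat x)))"
        if s3: "s3 = s2(''y'' := if x = 0 then 1 else 0, ''z'' := if x = 0 then 1 else 0)" for s3
      proof (rule wp_frame[OF sum], goal_cases)
        case (9 k3 s4 h4)
        then have "s4 ''q'' = of_nat q" "s4 ''N'' = of_nat N" "s4 ''x'' = of_nat x" "h4 = ?fill x"
          "s4 ''y'' = ?f x" "s4 ''z'' = ?g x" "k3 \<le> 207 * n + 50"
          using s2 s3 by simp_all
        then show ?case
          using addr fill_fill_Suc[OF x(2), of h "5 * q" ?f ?g]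
          by (simp add: wp_Store[where i = "5 * q + x"] wp_Store[where i = "5 * q + (N + x)"])
      qed (use s2 s3 in simp_all)
      have init: "wp m (IfLess (Const 0) (Var ''x'') (Assign ''y'' (Const 0)) (Assign ''y'' (Const 1))) (s2, h2) R
        \<longleftrightarrow> R 5 (s2(''y'' := if x = 0 then 1 else 0), h2)" for R
        using s2(4) by (simp add: wp_IfLess wp_Assign eval_nat_numeral)
      show ?case
        unfolding init wp_Assign
        unfolding s2(7)
        apply (rule wp_mono[OF store])
         apply simp
        apply (erule wp_mono)
        apply (erule wp_mono)
        using s2(8) apply (auto split: prod.splits)
        done
    qed
  next
    case (final k s1 h1)
    then show ?case by (simp add: N_def algebra_simps)
  qed (use s in \<open>simp_all add: N_def\<close>)
qed

section \<open>The program for the likelihood\<close>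

text \<open>The entries for the full vertex set, whose code is \<open>2\<^sup>n - 1\<close>, are \<open>F\<close> and the permanent; \<open>g\<close> becomes the
  constant coefficient of the latter.\<close>

definition finish :: prog where
  "finish =
     Load ''y'' (block 5 (Sub (Var ''N'') (Const 1))) ;;
     Load ''z'' (block 5 (Add (Var ''N'') (Sub (Var ''N'') (Const 1)))) ;;
     Assign ''c'' (Add (Var ''f'') (Const 1)) ;;
     Assign ''g'' (Sub (Floor (Var ''z'')) (Mul (Var ''c'') (Floor (Div (Var ''z'') (Var ''c''))))) ;;
     Assign ''result'' (Div (Var ''y'') (Mul (Var ''f'') (Var ''g'')))"

lemma wp_finish:
  assumes s: "s ''q'' = of_nat q" "s ''N'' = of_nat N" "s ''f'' = of_nat f"
    and m: "5 * q + 2 * N \<le> m" and N: "N > 0"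
    and z: "h (5 * q + (N + (N - 1))) = z"
  shows "wp m finish (s, h) (\<lambda>k (s', h'). k \<le> 100 \<and>
    s' ''result'' = h (5 * q + (N - 1)) /
      (of_nat f * (of_int \<lfloor>z\<rfloor> - of_nat (f + 1) * of_int \<lfloor>z / of_nat (f + 1)\<rfloor>)))"
proof -
  obtain N' where N': "N = N' + 1" using N by (metis Suc_eq_plus1 gr0_implies_Suc)
  have "5 * q + N' < m" "5 * q + (N' + 1 + N') < m" using m N' by linarith+
  then show ?thesis
    unfolding finish_def using s z N'
    by (simp add: wp_straight wp_Load[where i = "5 * q + N'"] wp_Load[where i = "5 * q + (N' + 1 + N')"]
        add.commute[of "1 :: rat" "of_nat f"])
qed

text \<open>Appends a phase that fills a table. The property \<open>P\<close> of the scalar variables concerns none that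
  the phase writes.\<close>

lemma wp_Seq_append:
  assumes "wp m p \<sigma> (\<lambda>k (s, h). k \<le> K \<and> h = h1 \<and> P s)"
    and "\<And>s. P s \<Longrightarrow> wp m r (s, h1) (\<lambda>k (s', h'). k \<le> L \<and> h' = h2)"
    and "\<And>s s'. P s \<Longrightarrow> (\<And>z. z \<notin> written r \<Longrightarrow> s' z = s z) \<Longrightarrow> P s'"
  shows "wp m (p ;; r) \<sigma> (\<lambda>k (s, h). k \<le> K + L \<and> h = h2 \<and> P s)"
  unfolding wp_Seq
proof (rule wp_mono[OF assms(1)])
  fix k and \<sigma>' :: state
  assume *: "case \<sigma>' of (s, h) \<Rightarrow> k \<le> K \<and> h = h1 \<and> P s"
  obtain s h where \<sigma>': "\<sigma>' = (s, h)" by (cases \<sigma>')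
  with * have "k \<le> K" "h = h1" "P s" by simp_all
  have "wp m r (s, h1) (\<lambda>l (s', h'). k + l \<le> K + L \<and> h' = h2 \<and> P s')"
    by (rule wp_frame[OF assms(2)[OF \<open>P s\<close>]]) (use \<open>k \<le> K\<close> assms(3)[OF \<open>P s\<close>] in auto)
  then show "wp m r \<sigma>' (\<lambda>l \<sigma>''. case \<sigma>'' of (s, h) \<Rightarrow> k + l \<le> K + L \<and> h = h2 \<and> P s)"
    using \<sigma>' \<open>h = h1\<close> by simp
qed

definition likelihood_program :: prog where
  "likelihood_program =
     (((((Assign ''q'' (Mul (Var ''n'') (Var ''n'')) ;; factorials) ;; rows) ;; digit_powers) ;;
       weight_codes) ;; subset_table) ;; finish"

text \<open>One summand for each phase of the program.\<close>

definition time_bound :: "nat \<Rightarrow> nat" where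
  "time_bound n = (100 * n + 104) + (200 * (n * n) + 100 * n + 100) + (100 * (n * n) + 100) +
     (n * n * (107 * n + 100) + 100) + (2 ^ n * (264 * n + 200) + 100) + 100"

definition space_bound :: "nat \<Rightarrow> nat" where
  "space_bound n = 5 * (n * n) + 2 * 2 ^ n"

text \<open>The phases compose because each table lies above all tables it is computed from: reading below
  a later \<open>fill\<close> sees through it. In the end \<open>F\<close> is divided by \<open>n!\<close> times the extracted coefficient,
  which is the likelihood by \<open>likelihood_eq\<close> and \<open>card_Aut_eq_floor\<close>.\<close>

lemma wp_likelihood_program:
  assumes G: "simple_graph G" "verts G = {..<n}"
  shows "wp (space_bound n) likelihood_program (input_state n G)
    (\<lambda>k \<sigma>. k \<le> time_bound n \<and> of_rat (result \<sigma>) = likelihood G)"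
proof -
  define q where "q = n * n"
  define N :: nat where "N = 2 ^ n"
  let ?m = "space_bound n"
  let ?X = "of_nat (fact n + 1) :: rat"
  obtain s0 h0 where input: "input_state n G = (s0, h0)" by (cases "input_state n G")
  have s0: "s0 ''n'' = of_nat n" using input by (auto simp: input_state_def)
  have h0: "h0 (u * n + v) = of_nat (adj G u v)" if "u < n" "v < n" for u v
    using input matrix_index_less[OF that] that by (auto simp: input_state_def adj_def)
  have nq: "n \<le> q" by (simp add: q_def)
  have m: "5 * q + 2 * N \<le> ?m" by (simp add: space_bound_def q_def N_def)
  with nq have m1: "q + n \<le> ?m" by linarith
  let ?P = "\<lambda>s :: string \<Rightarrow> rat. s ''n'' = of_nat n \<and> s ''q'' = of_nat q \<and> s ''f'' = fact n \<and> s ''N'' = of_nat N"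
  let ?h1 = "fill h0 q n fact"
  let ?h2 = "fill ?h1 (2 * q) n (\<lambda>u. of_nat (packed_row n G u))"
  let ?h3 = "fill ?h2 (3 * q) q (\<lambda>i. ?X ^ (3 ^ i))"
  let ?h4 = "fill ?h3 (4 * q) q (\<lambda>i. weight_code n G (i div n) (i mod n))"
  let ?h5 = "fill (fill ?h4 (5 * q) N (\<lambda>x. F_rat G (set_decode x))) (5 * q + N) N
      (\<lambda>x. perm_sum (weight_code n G) (set_decode x))"
  let ?p1 = "Assign ''q'' (Mul (Var ''n'') (Var ''n'')) ;; factorials"
  have 1: "wp ?m ?p1 (s0, h0) (\<lambda>k (s, h). k \<le> 100 * n + 104 \<and> h = ?h1 \<and> ?P s)"
    unfolding wp_Seq wp_Assign
    by (rule wp_frame[OF wp_factorials[where n = n]])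
      (use s0 m1 in \<open>auto simp: q_def N_def factorials_def\<close>)
  have 2: "wp ?m (?p1 ;; rows) (s0, h0)
      (\<lambda>k (s, h). k \<le> 100 * n + 104 + (200 * q + 100 * n + 100) \<and> h = ?h2 \<and> ?P s)"
  proof (rule wp_Seq_append[OF 1])
    fix s assume "?P s"
    then show "wp ?m rows (s, ?h1) (\<lambda>k (s', h'). k \<le> 200 * q + 100 * n + 100 \<and> h' = ?h2)"
      unfolding q_def
    proof (intro wp_rows, goal_cases)
      case 3
      then show ?case using m by (simp add: q_def)
    next
      case (4 u v)
      then show ?case using matrix_index_less[OF 4(2,3)] h0[OF 4(2,3)] by (simp add: fill_below)
    qed simp_all
  qed (auto simp: rows_def)
  have 3: "wp ?m ((?p1 ;; rows) ;; digit_powers) (s0, h0)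
      (\<lambda>k (s, h). k \<le> 100 * n + 104 + (200 * q + 100 * n + 100) + (100 * q + 100) \<and> h = ?h3 \<and> ?P s)"
  proof (rule wp_Seq_append[OF 2])
    fix s assume "?P s"
    then show "wp ?m digit_powers (s, ?h2) (\<lambda>k (s', h'). k \<le> 100 * q + 100 \<and> h' = ?h3)"
      using m by (intro wp_digit_powers) auto
  qed (auto simp: digit_powers_def)
  have h3: "?h3 (u * n + v) = of_nat (adj G u v)" if "u < n" "v < n" for u v
    using matrix_index_less[OF that] h0[OF that] by (simp add: fill_below q_def)
  have 4: "wp ?m (((?p1 ;; rows) ;; digit_powers) ;; weight_codes) (s0, h0)
      (\<lambda>k (s, h). k \<le> 100 * n + 104 + (200 * q + 100 * n + 100) + (100 * q + 100) +
        (q * (107 * n + 100) + 100) \<and> h = ?h4 \<and> ?P s)"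
  proof (rule wp_Seq_append[OF 3])
    fix s assume s: "?P s"
    show "wp ?m weight_codes (s, ?h3) (\<lambda>k (s', h'). k \<le> q * (107 * n + 100) + 100 \<and> h' = ?h4)"
      unfolding q_def
    proof (rule wp_weight_codes, goal_cases)
      case (4 u v)
      then show ?case using h3[OF 4] by (simp only: q_def)
    next
      case (5 i)
      then show ?case by (rule fill_inside)
    qed (use s m in \<open>simp_all add: q_def\<close>)
  qed (auto simp: weight_codes_def)
  have h4: "?h4 (q + i) = fact i" "?h4 (2 * q + i) = of_nat (packed_row n G i)" if "i < n" for i
  proof -
    have "i < q" using that nq by linarith
    then show "?h4 (q + i) = fact i" "?h4 (2 * q + i) = of_nat (packed_row n G i)"
      using that by (simp_all add: fill_below fill_inside)
  qed
  have h4': "?h4 (4 * q + (u * n + v)) = weight_code n G u v" if "u < n" "v < n" for u v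
    using matrix_index_less[OF that] that by (simp add: fill_inside q_def[symmetric])
  have 5: "wp ?m ((((?p1 ;; rows) ;; digit_powers) ;; weight_codes) ;; subset_table) (s0, h0)
      (\<lambda>k (s, h). k \<le> 100 * n + 104 + (200 * q + 100 * n + 100) + (100 * q + 100) +
        (q * (107 * n + 100) + 100) + (2 ^ n * (264 * n + 200) + 100) \<and> h = ?h5 \<and> ?P s)"
  proof (rule wp_Seq_append[OF 4])
    fix s assume s: "?P s"
    show "wp ?m subset_table (s, ?h4) (\<lambda>k (s', h'). k \<le> 2 ^ n * (264 * n + 200) + 100 \<and> h' = ?h5)"
      unfolding q_def N_def
    proof (rule wp_subset_table[OF _ _ _ _ G(1)], goal_cases)
      case (5 i)
      then show ?case using h4(1)[OF 5] by (simp only: q_def)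
    next
      case (6 u)
      then show ?case using h4(2)[OF 6] by (simp only: q_def)
    next
      case (7 u v)
      then show ?case using h4'[OF 7] by (simp only: q_def)
    qed (use s m in \<open>simp_all add: q_def N_def\<close>)
  qed (auto simp: subset_table_def)
  have "N > 0" by (simp add: N_def)
  let ?z = "perm_sum (weight_code n G) {..<n}"
  have full: "set_decode (N - 1) = {..<n}" unfolding N_def by (rule set_decode_full)
  have z: "?h5 (5 * q + (N + (N - 1))) = ?z"
    using fill_inside[of "N - 1" N _ "5 * q + N"] \<open>N > 0\<close> full by (simp add: add.assoc)
  have y: "?h5 (5 * q + (N - 1)) = F_rat G {..<n}"
  proof -
    have "N - 1 < N" using \<open>N > 0\<close> by simp
    then have "?h5 (5 * q + (N - 1)) = fill ?h4 (5 * q) N (\<lambda>x. F_rat G (set_decode x)) (5 * q + (N - 1))"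
      by (intro fill_below) simp
    also have "\<dots> = F_rat G (set_decode (N - 1))" using \<open>N - 1 < N\<close> by (rule fill_inside)
    finally show ?thesis unfolding full .
  qed
  have Aut: "of_int \<lfloor>?z\<rfloor> - of_nat (fact n + 1) * of_int \<lfloor>?z / of_nat (fact n + 1)\<rfloor> = (of_nat (card (Aut G)) :: rat)"
    using card_Aut_eq_floor[OF G] unfolding weight_code_def by simp
  have "(of_rat (fact n) :: real) = fact n"
    by (metis of_nat_fact of_rat_of_nat_eq)
  then have like: "of_rat (F_rat G {..<n} / (of_nat (fact n) * of_nat (card (Aut G)))) = likelihood G"
    using of_rat_F_rat[OF G(1), of "{..<n}"] likelihood_eq[OF G(1)] G(2)
    by (simp add: of_rat_divide of_rat_mult)
  show ?thesis
    unfolding likelihood_program_def input wp_Seq[of _ _ finish]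
  proof (rule wp_mono[OF 5], clarify)
    fix k and s :: "string \<Rightarrow> rat"
    assume k: "k \<le> 100 * n + 104 + (200 * q + 100 * n + 100) + (100 * q + 100) +
        (q * (107 * n + 100) + 100) + (2 ^ n * (264 * n + 200) + 100)"
      and s: "s ''n'' = of_nat n" "s ''q'' = of_nat q" "s ''f'' = fact n" "s ''N'' = of_nat N"
    show "wp ?m finish (s, ?h5) (\<lambda>l \<sigma>. k + l \<le> time_bound n \<and> of_rat (result \<sigma>) = likelihood G)"
    proof (rule wp_mono[OF wp_finish[where h = ?h5 and f = "fact n", OF s(2,4) _ m \<open>N > 0\<close> z]])
      show "s ''f'' = of_nat (fact n)" using s(3) by simp
      fix l :: nat and \<sigma> :: state
      assume "case \<sigma> of (s', h') \<Rightarrow> l \<le> 100 \<and> s' ''result'' = ?h5 (5 * q + (N - 1)) /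
        (of_nat (fact n) * (of_int \<lfloor>?z\<rfloor> - of_nat (fact n + 1) * of_int \<lfloor>?z / of_nat (fact n + 1)\<rfloor>))"
      then have "l \<le> 100" "result \<sigma> = F_rat G {..<n} / (of_nat (fact n) * of_nat (card (Aut G)))"
        unfolding y Aut result_def by (auto split: prod.splits)
      then show "k + l \<le> time_bound n \<and> of_rat (result \<sigma>) = likelihood G"
        using k like by (simp add: time_bound_def q_def)
    qed
  qed
qed

lemma time_bound_in_bigo: "(\<lambda>n. real (time_bound n)) \<in> O(\<lambda>n. real n * 2 ^ n)"
  unfolding time_bound_def by simp real_asymp

lemma space_bound_in_bigo: "(\<lambda>n. real (space_bound n)) \<in> O(\<lambda>n. 2 ^ n)"
  unfolding space_bound_def by simp real_asymp

lemma computable_likelihood: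
  "computable_within likelihood (\<lambda>n. real n * 2 ^ n) (\<lambda>n. 2 ^ n)"
  unfolding computable_within_def
proof (rule exI[of _ likelihood_program], rule exI[of _ time_bound], rule exI[of _ space_bound],
    intro conjI allI impI)
  fix n :: nat and G :: "nat graph"
  assume "n \<ge> 1" "simple_graph G \<and> verts G = {..<n}"
  then show "\<exists>k \<sigma>. exec (space_bound n) likelihood_program (input_state n G) k \<sigma> \<and> k \<le> time_bound n \<and>
      of_rat (result \<sigma>) = likelihood G"
    using wp_likelihood_program[of G n] unfolding wp_def by blast
qed (rule time_bound_in_bigo, rule space_bound_in_bigo)

theorem corollary9:
  shows "(\<forall>G :: 'a graph. simple_graph G \<and> verts G \<noteq> {} \<longrightarrow>
            likelihood G =
              F G (verts G) / (fact (card (verts G)) * real (card (Aut G)))) \<and>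
         computable_within likelihood (\<lambda>n. real n * 2 ^ n) (\<lambda>n. 2 ^ n)"
  using likelihood_eq computable_likelihood by blast

end
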